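(* Let $a>0$ and $p=2\pi/a$. Suppose $$\sum_{n=1}^{\infty}B_{n}\sin(an\lambda)$$ is the Fourier series of a real, odd, measurable, $p$-periodic function $\Psi(\lambda)$ on $\mathbb{R}$ satisfying $|\Psi(\lambda)|\le 1/2$. Then the corresponding function $S\in\mathcal{W}_p$ given by $$S(w)=\frac{1}{2}\int_{\mathbb{R}}\frac{\Psi(\lambda)\sinh\left(\frac{w}{2}\right)}{\cosh\left(\frac{\lambda}{2}\right)\cosh\left(\frac{w-\lambda}{2}\right)}\,d\lambda,\qquad w\in D,$$ is given by the Fourier series $$S(w)=\pi\sum_{n=1}^{\infty}B_{n}\frac{1-\cos(awn)}{\sinh(a\pi n)}=2\pi\sum_{n=1}^{\infty}B_{n}\frac{\sin^{2}\left(\frac{awn}{2}\right)}{\sinh(a\pi n)},\qquad w\in D.$$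
   Context: $D=\{w\in\mathbb{C}:-\pi<\operatorname{Im}w<\pi\}$. For $p>0$, $\mathcal{W}_p$ denotes the set of all analytic functions $S:D\to\mathbb{C}$ such that: (i) $|\operatorname{Im}S(w)|\le\frac12\operatorname{Im}w$ whenever $0\le\operatorname{Im}w<\pi$; (ii) $S(0)=0$; (iii) $S(-w)=S(w)$ for all $w\in D$; (iv) $S(w+p)=S(w)$ for all $w\in D$. *)

theory Defs
  imports "HOL-Complex_Analysis.Complex_Analysis"
begin

definition strip :: "complex set" where
  "strip = {w. - pi < Im w \<and> Im w < pi}"

text \<open>Functions on the strip are total functions on the complex numbers of which only the values
  on the strip matter: every condition below is restricted to it.\<close>

definition W_class :: "real \<Rightarrow> (complex \<Rightarrow> complex) set" where
  "W_class p = {S. S analytic_on strip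
      \<and> (\<forall>w. 0 \<le> Im w \<and> Im w < pi \<longrightarrow> \<bar>Im (S w)\<bar> \<le> 1/2 * Im w)
      \<and> S 0 = 0
      \<and> (\<forall>w\<in>strip. S (- w) = S w)
      \<and> (\<forall>w\<in>strip. S (w + of_real p) = S w)}"

text \<open>The trigonometric series
  \<open>A 0 / 2 + (\<Sum>n\<ge>1. A n * cos (2 * pi * n * x / p) + B n * sin (2 * pi * n * x / p))\<close>
  is the Fourier series of the \<open>p\<close>-periodic function \<open>f\<close>; this fixes the coefficients and says
  nothing about convergence. The value \<open>B 0\<close> is irrelevant.\<close>

definition is_fourier_series ::
  "real \<Rightarrow> (real \<Rightarrow> real) \<Rightarrow> (nat \<Rightarrow> real) \<Rightarrow> (nat \<Rightarrow> real) \<Rightarrow> bool" where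
  "is_fourier_series p f A B \<longleftrightarrow>
     set_integrable lebesgue {-p/2..p/2} f
     \<and> (\<forall>n. A n = 2 / p * (LINT x:{-p/2..p/2}|lebesgue. f x * cos (2 * pi * real n * x / p)))
     \<and> (\<forall>n\<ge>1. B n = 2 / p * (LINT x:{-p/2..p/2}|lebesgue. f x * sin (2 * pi * real n * x / p)))"

end

theory Submission
  imports Defs "HOL-Real_Asymp.Real_Asymp"
begin

text \<open>The kernel is \<open>K w x = tanh ((w - x) / 2) + tanh (x / 2)\<close>. A contour integral over a
  rectangle of height \<open>2 * pi\<close>, together with the \<open>2 * pi * \<i>\<close>-periodicity of the kernel in \<open>x\<close>,
  gives the integral of \<open>sin (s * x) * K w x\<close> over the real line in closed form. As \<open>\<Psi>\<close> is odd and
  periodic, integration of \<open>\<Psi>\<close> against \<open>K w\<close> over the line is integration of \<open>\<Psi>\<close> against a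
  continuous function on half a period, obtained by folding the kernel. The closed form yields
  the sine coefficients of the folded kernel, which decay geometrically; hence it equals its
  absolutely convergent sine series, and integrating that series against \<open>\<Psi>\<close> gives the formula
  for \<open>S\<close>. Analyticity, evenness and periodicity are read off the series, and the bound on \<open>Im S\<close>
  follows from \<open>Im (K w x) \<ge> 0\<close> and the fact that \<open>Im (K w)\<close> has integral \<open>2 * Im w\<close>.\<close>

section \<open>The kernel\<close>

text \<open>A bounded measurable \<open>\<Psi>\<close> need not be the pointwise sum of its Fourier
  series, so that series cannot simply be inserted under the integral. The expansion is therefore
  moved to the kernel, and \<open>\<Psi>\<close> enters only through its integrals against sines,
  that is, through the \<open>B n\<close>. The folded kernel is matched with its series by
  uniqueness of the sine coefficients of a continuous function, which avoids pointwise convergence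
  theorems. Folding is used a second time, with a sine in place of \<open>\<Psi>\<close>, to turn
  those coefficients into integrals over the whole line. The shape of the answer is visible in the
  contour integral: for nonzero \<open>w\<close> the rectangle contains the poles
  \<open>\<i> * pi\<close> and \<open>w + \<i> * pi\<close>, whose residues produce
  \<open>1 - exp (\<i> * s * w)\<close> and hence \<open>1 - cos\<close>; comparing the horizontal
  sides gives \<open>1 - exp (- 2 * pi * s) = 2 * exp (- pi * s) * sinh (pi * s)\<close> and hence
  the denominators. The condition \<open>\<bar>Im w\<bar> < pi\<close> both keeps the poles off the
  real line and makes the coefficients decay.\<close>

definition strip_kernel :: "complex \<Rightarrow> complex \<Rightarrow> complex" where
  "strip_kernel w z = sinh (w / 2) / (cosh (z / 2) * cosh ((w - z) / 2))"

section \<open>Modulus and zeros of the complex hyperbolic cosine\<close>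

lemma cosh_of_real: "cosh (of_real x) = (of_real (cosh x) :: complex)"
  and sinh_of_real: "sinh (of_real x) = (of_real (sinh x) :: complex)"
  by (simp_all add: cosh_def sinh_def scaleR_conv_of_real flip: exp_of_real of_real_minus)

lemma cosh_of_real_half: "cosh (of_real x / 2) = (of_real (cosh (x / 2)) :: complex)"
  using cosh_of_real[of "x / 2"] by simp

lemma cosh_Complex: "cosh z = Complex (cosh (Re z) * cos (Im z)) (sinh (Re z) * sin (Im z))"
  by (simp add: complex_eq_iff cosh_def sinh_def Re_exp Im_exp field_simps)

lemma sinh_Complex: "sinh z = Complex (sinh (Re z) * cos (Im z)) (cosh (Re z) * sin (Im z))"
  by (simp add: complex_eq_iff cosh_def sinh_def Re_exp Im_exp field_simps)

text \<open>Real and imaginary part of the argument separate into a sum of squares. This locates the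
  zeros of \<open>cosh\<close> and gives two lower bounds: \<open>norm_cosh_ge_sinh\<close>,
  independent of \<open>Im z\<close>, for the vertical sides of the contour, and
  \<open>norm_cosh_ge_cos\<close> for the real line.\<close>

lemma norm_cosh_squared: "(norm (cosh z))\<^sup>2 = (sinh (Re z))\<^sup>2 + (cos (Im z))\<^sup>2" for z :: complex
proof -
  have "(norm (cosh z))\<^sup>2 = (cosh (Re z) * cos (Im z))\<^sup>2 + (sinh (Re z) * sin (Im z))\<^sup>2"
    by (simp add: cosh_Complex cmod_power2)
  also have "\<dots> = (sinh (Re z))\<^sup>2 + (cos (Im z))\<^sup>2"
    by (simp add: power_mult_distrib cosh_square_eq sin_squared_eq algebra_simps)
  finally show ?thesis .
qed

lemma norm_cosh_ge_sinh: "\<bar>sinh (Re z)\<bar> \<le> norm (cosh z)" for z :: complex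
  by (rule power2_le_imp_le) (simp_all add: norm_cosh_squared)

lemma norm_cosh_ge_cos: "\<bar>cos (Im z)\<bar> * cosh (Re z) \<le> norm (cosh z)" for z :: complex
proof (rule power2_le_imp_le)
  have "(cos (Im z))\<^sup>2 * (sinh (Re z))\<^sup>2 \<le> 1 * (sinh (Re z))\<^sup>2"
    by (intro mult_right_mono) (auto simp: abs_square_le_1)
  thus "(\<bar>cos (Im z)\<bar> * cosh (Re z))\<^sup>2 \<le> (norm (cosh z))\<^sup>2"
    by (simp add: norm_cosh_squared power_mult_distrib cosh_square_eq algebra_simps)
qed simp

lemma cosh_ge_exp_abs: "exp \<bar>x\<bar> / 2 \<le> cosh x" for x :: real
  by (cases "x \<ge> 0") (auto simp: cosh_def)

lemma Im_less_half_pi: "w \<in> strip \<Longrightarrow> \<bar>Im w / 2\<bar> < pi / 2"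
  by (auto simp: strip_def)

lemma cos_half_pos: "w \<in> strip \<Longrightarrow> cos (Im w / 2) > 0"
  using Im_less_half_pi[of w] by (intro cos_gt_zero_pi) auto

text \<open>The width of the strip enters here: the argument has imaginary part
  \<open>Im w / 2\<close>, strictly between the zeros \<open>- pi / 2\<close> and
  \<open>pi / 2\<close> of the cosine.\<close>

lemma cosh_half_diff_nonzero: "w \<in> strip \<Longrightarrow> cosh ((w - of_real x) / 2) \<noteq> 0"
  using norm_cosh_ge_cos[of "(w - of_real x) / 2"] cos_half_pos[of w]
    mult_pos_pos[of "cos (Im w / 2)" "cosh ((Re w - x) / 2)"]
  by fastforce

lemma continuous_on_strip_kernel:
  "w \<in> strip \<Longrightarrow> continuous_on A (\<lambda>x::real. strip_kernel w (of_real x))"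
  unfolding strip_kernel_def
  by (intro continuous_intros)
     (auto simp: cosh_half_diff_nonzero cosh_of_real_half)

text \<open>Each of the two \<open>cosh\<close> factors in the denominator contributes decay of
  order \<open>exp (- \<bar>x\<bar> / 2)\<close>.\<close>

lemma norm_strip_kernel_le:
  assumes "w \<in> strip"
  obtains C where "C \<ge> 0" "\<And>x::real. norm (strip_kernel w (of_real x)) \<le> C * exp (- \<bar>x\<bar>)"
proof
  \<comment> \<open>The 4 comes from using \<open>cosh_ge_exp_abs\<close> twice,
    \<open>exp (\<bar>Re w\<bar> / 2)\<close> from
    \<open>\<bar>Re w - x\<bar> \<ge> \<bar>x\<bar> - \<bar>Re w\<bar>\<close>, and the cosine from
    \<open>norm_cosh_ge_cos\<close>.\<close>
  let ?C = "4 * norm (sinh (w / 2)) * exp (\<bar>Re w\<bar> / 2) / cos (Im w / 2)"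
  note cp = cos_half_pos[OF assms]
  show "?C \<ge> 0" using cp by simp
  fix x :: real
  have "exp \<bar>x / 2\<bar> / 2 * (cos (Im w / 2) * (exp ((\<bar>x\<bar> - \<bar>Re w\<bar>) / 2) / 2))
      \<le> cosh (x / 2) * norm (cosh ((w - of_real x) / 2))"
  proof (intro mult_mono)
    have "exp ((\<bar>x\<bar> - \<bar>Re w\<bar>) / 2) / 2 \<le> exp \<bar>(Re w - x) / 2\<bar> / 2"
      by (intro divide_right_mono) (simp_all add: abs_if field_simps)
    also have "\<dots> \<le> cosh ((Re w - x) / 2)" by (rule cosh_ge_exp_abs)
    finally have "cos (Im w / 2) * (exp ((\<bar>x\<bar> - \<bar>Re w\<bar>) / 2) / 2)
        \<le> cos (Im w / 2) * cosh ((Re w - x) / 2)"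
      using cp by (intro mult_left_mono) auto
    also have "\<dots> \<le> norm (cosh ((w - of_real x) / 2))"
      using norm_cosh_ge_cos[of "(w - of_real x) / 2"] cp by simp
    finally show "cos (Im w / 2) * (exp ((\<bar>x\<bar> - \<bar>Re w\<bar>) / 2) / 2) \<le> norm (cosh ((w - of_real x) / 2))" .
    show "exp \<bar>x / 2\<bar> / 2 \<le> cosh (x / 2)" by (rule cosh_ge_exp_abs)
  qed (use cp in auto)
  moreover have "exp \<bar>x / 2\<bar> / 2 * (cos (Im w / 2) * (exp ((\<bar>x\<bar> - \<bar>Re w\<bar>) / 2) / 2))
      = cos (Im w / 2) / (4 * exp (\<bar>Re w\<bar> / 2) * exp (- \<bar>x\<bar>))"
    by (simp add: field_simps exp_minus flip: exp_add)
  ultimately have D: "cos (Im w / 2) / (4 * exp (\<bar>Re w\<bar> / 2) * exp (- \<bar>x\<bar>))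
      \<le> cosh (x / 2) * norm (cosh ((w - of_real x) / 2))" (is "?d \<le> ?D") by simp
  have dp: "?d > 0" using cp by simp
  have "norm (strip_kernel w (of_real x)) = norm (sinh (w / 2)) / ?D"
    by (simp add: strip_kernel_def norm_divide norm_mult cosh_of_real_half)
  also have "\<dots> \<le> norm (sinh (w / 2)) / ?d"
    using D dp by (intro divide_left_mono mult_pos_pos) auto
  also have "\<dots> = ?C * exp (- \<bar>x\<bar>)" using cp by (simp add: field_simps)
  finally show "norm (strip_kernel w (of_real x)) \<le> ?C * exp (- \<bar>x\<bar>)" .
qed

section \<open>Integrability from exponential decay\<close>

lemma borel_measurable_lebesgue_continuous:
  "continuous_on UNIV f \<Longrightarrow> f \<in> borel_measurable lebesgue" for f :: "real \<Rightarrow> 'a::topological_space"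
  using borel_measurable_continuous_onI[of f] by (simp add: measurable_completion)

lemma integrable_exp_minus_abs: "integrable lebesgue (\<lambda>x::real. exp (- \<bar>x\<bar>))"
proof -
  have *: "set_integrable lebesgue {0..} (\<lambda>x::real. exp (- x))"
    using absolutely_integrable_on_def has_integral_exp_minus_to_infinity[of 1 0] 
    by (intro nonnegative_absolutely_integrable_1) (auto simp: integrable_on_def)
  let ?f = "\<lambda>x::real. indicator {0..} x *\<^sub>R exp (- x)"
  have 1: "integrable lebesgue ?f" using * by (simp add: set_integrable_def)
  have 2: "integrable lebesgue (\<lambda>x. ?f (- x))"
    using lebesgue_integrable_real_affine[OF 1, of "-1" 0] by simp
  show ?thesis
    by (rule Bochner_Integration.integrable_bound[OF Bochner_Integration.integrable_add[OF 1 2]])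
       (auto simp: indicator_def intro!: borel_measurable_continuous_onI measurable_completion continuous_on_exp continuous_on_minus continuous_on_rabs continuous_on_id)
qed

lemma integrable_exp_bound:
  fixes f :: "real \<Rightarrow> 'a::{banach, second_countable_topology}"
  assumes "f \<in> borel_measurable lebesgue" "\<And>x. norm (f x) \<le> C * exp (- \<bar>x\<bar>)"
  shows "integrable lebesgue f"
  by (rule Bochner_Integration.integrable_bound[OF integrable_mult_right[OF integrable_exp_minus_abs, of C]])
     (use assms order_trans[OF _ abs_ge_self] in auto)

section \<open>Folding the line onto half a period\<close>

lemma periodic_add_nat_mult:
  fixes \<psi> :: "real \<Rightarrow> real"
  assumes "\<And>x. \<psi> (x + p) = \<psi> x"
  shows "\<psi> (x + real k * p) = \<psi> x"
proof (induction k)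
  case (Suc k)
  have "\<psi> (x + real (Suc k) * p) = \<psi> ((x + real k * p) + p)" by (simp add: algebra_simps)
  thus ?case using assms Suc by simp
qed simp

text \<open>A locale because it has two kinds of instances: \<open>\<Psi>\<close> with bound 1/2,
  and the sines \<open>sin (a * n * x)\<close> with bound 1, which serve to compute the coefficients
  of the folded kernel.\<close>

locale odd_periodic =
  fixes \<psi> :: "real \<Rightarrow> real" and p M :: real
  assumes p_pos: "p > 0"
    and meas: "\<psi> \<in> borel_measurable lebesgue"
    and odd: "\<And>x. \<psi> (- x) = - \<psi> x"
    and periodic: "\<And>x. \<psi> (x + p) = \<psi> x"
    and bounded: "\<And>x. \<bar>\<psi> x\<bar> \<le> M"
begin

lemma M_nonneg: "M \<ge> 0"
  using bounded[of 0] by linarith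

lemma zero: "\<psi> 0 = 0"
  using odd[of 0] by simp

text \<open>Periodicity and oddness give opposite values at \<open>p / 2\<close>. Together with
  \<open>zero\<close> this means that identities between functions multiplied by
  \<open>\<psi>\<close> only have to be checked inside the open half-period.\<close>

lemma half: "\<psi> (p / 2) = 0"
  using periodic[of "- (p / 2)"] odd[of "p / 2"] by simp

lemma shift: "\<psi> (real k * p + x) = \<psi> x"
  using periodic_add_nat_mult[of \<psi> p x k, OF periodic] by (simp add: add.commute)

lemma reflect: "\<psi> ((real k + 1) * p - x) = - \<psi> x"
  using shift[of "Suc k" "- x"] by (simp add: odd algebra_simps)

end

text \<open>The kernel which remains after folding the real line, modulo the period and the reflection
  at the origin, onto half a period.\<close>

definition folded_term :: "real \<Rightarrow> (real \<Rightarrow> complex) \<Rightarrow> nat \<Rightarrow> real \<Rightarrow> complex" where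
  "folded_term p g k x = (g (real k * p + x) - g (- (real k * p + x)))
     - (g ((real k + 1) * p - x) - g (- ((real k + 1) * p - x)))"

text \<open>Let \<open>G x\<close> be the sum of \<open>g (x + m * p)\<close> over all integers
  \<open>m\<close>. Then this is \<open>G x - G (- x)\<close>, twice the odd part of the
  periodization; each group of four terms belongs to one period of the half-line.\<close>

definition folded :: "real \<Rightarrow> (real \<Rightarrow> complex) \<Rightarrow> real \<Rightarrow> complex" where
  "folded p g x = (\<Sum>k. folded_term p g k x)"

locale exp_decaying =
  fixes g :: "real \<Rightarrow> complex" and C :: real
  assumes cont: "continuous_on UNIV g"
    and decay: "\<And>x. norm (g x) \<le> C * exp (- \<bar>x\<bar>)"
begin

lemma C_nonneg: "C \<ge> 0"
  using order_trans[OF norm_ge_zero decay[of 0]] by simp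

text \<open>On the half-period all four arguments of \<open>g\<close> have absolute value at least
  \<open>k * p\<close>.\<close>

lemma norm_folded_term:
  assumes p: "p > 0" and x: "x \<in> {0..p/2}"
  shows "norm (folded_term p g k x) \<le> 4 * C * exp (- p) ^ k"
proof -
  have *: "norm (g y) \<le> C * exp (- p) ^ k" if "real k * p \<le> \<bar>y\<bar>" for y
  proof -
    have "exp (- \<bar>y\<bar>) \<le> exp (- p) ^ k" using that by (simp flip: exp_of_nat_mult)
    thus ?thesis using order_trans[OF decay mult_left_mono[OF _ C_nonneg]] by blast
  qed
  have k: "0 \<le> real k * p" using p by simp
  have "real k * p \<le> \<bar>real k * p + x\<bar>" "real k * p \<le> \<bar>- (real k * p + x)\<bar>"
    using x k by auto
  moreover have "real k * p \<le> \<bar>(real k + 1) * p - x\<bar>" "real k * p \<le> \<bar>- ((real k + 1) * p - x)\<bar>"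
    using x k p unfolding distrib_right by auto
  ultimately have "norm (folded_term p g k x) \<le> (C * exp (- p) ^ k + C * exp (- p) ^ k) + (C * exp (- p) ^ k + C * exp (- p) ^ k)"
    unfolding folded_term_def
    by (intro order_trans[OF norm_triangle_ineq4] add_mono *)
  thus ?thesis by simp
qed

lemma summable_majorant: "p > 0 \<Longrightarrow> summable (\<lambda>k. 4 * C * exp (- p) ^ k)" for p :: real
  by (intro summable_mult summable_geometric) simp

lemma folded_term_continuous: "continuous_on A (folded_term p g k)"
  unfolding folded_term_def
  by (intro continuous_intros continuous_on_compose2[OF cont]) auto

lemma continuous_on_folded:
  assumes "p > 0"
  shows "continuous_on {0..p/2} (folded p g)"
proof -
  have "uniform_limit {0..p/2} (\<lambda>n x. \<Sum>k<n. folded_term p g k x) (folded p g) sequentially"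
    unfolding folded_def
    by (rule Weierstrass_m_test[OF norm_folded_term summable_majorant]) (use assms in auto)
  thus ?thesis
    by (rule uniform_limit_theorem[rotated])
       (auto intro!: always_eventually continuous_intros folded_term_continuous)
qed

end

section \<open>Integrals over the line against an odd periodic function\<close>

locale half_period_folding = odd_periodic + exp_decaying
begin

definition h :: "real \<Rightarrow> complex" where "h x = of_real (\<psi> x) * (g x - g (- x))"

lemma g_meas: "g \<in> borel_measurable lebesgue"
  by (rule borel_measurable_lebesgue_continuous[OF cont])

lemma F_integrable: "integrable lebesgue (\<lambda>x. of_real (\<psi> x) * g x)"
proof (rule integrable_exp_bound)
  show "(\<lambda>x. complex_of_real (\<psi> x) * g x) \<in> borel_measurable lebesgue"
    using meas g_meas by measurable
  show "norm (of_real (\<psi> x) * g x) \<le> (M * C) * exp (- \<bar>x\<bar>)" for x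
    using mult_mono[OF bounded[of x] decay[of x]] M_nonneg by (simp add: norm_mult mult_ac)
qed

text \<open>The reflected argument is spelled \<open>0 + (- 1) * x\<close> to fit the affine change
  of variables.\<close>

lemma h_eq: "h x = of_real (\<psi> x) * g x + of_real (\<psi> (0 + (- 1) * x)) * g (0 + (- 1) * x)"
  by (simp add: h_def odd algebra_simps)

lemma h_integrable: "integrable lebesgue h"
  unfolding h_eq
  by (intro Bochner_Integration.integrable_add F_integrable
        lebesgue_integrable_real_affine[of "\<lambda>x. of_real (\<psi> x) * g x"]) auto

lemma integral_half_line: "(LINT x|lebesgue. of_real (\<psi> x) * g x) = (LINT x:{0..}|lebesgue. h x)"
proof -
  let ?F = "\<lambda>x. of_real (\<psi> x) * g x"
  let ?u = "\<lambda>x. indicator {0..} x *\<^sub>R ?F x" and ?v = "\<lambda>x. indicator {..0} x *\<^sub>R ?F x"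
  have u: "integrable lebesgue ?u" and v: "integrable lebesgue ?v"
    using F_integrable by (intro integrable_mult_indicator; simp)+
  have v': "integrable lebesgue (\<lambda>x. ?v (0 + (- 1) * x))"
    by (intro lebesgue_integrable_real_affine v) simp
  \<comment> \<open>The closed half-lines share the origin, where \<open>\<psi>\<close>
    vanishes.\<close>
  have "(LINT x|lebesgue. ?F x) = (LINT x|lebesgue. ?u x + ?v x)"
    by (intro Bochner_Integration.integral_cong) (auto simp: indicator_def zero)
  also have "\<dots> = (LINT x|lebesgue. ?u x) + (LINT x|lebesgue. ?v x)"
    by (rule Bochner_Integration.integral_add[OF u v])
  also have "(LINT x|lebesgue. ?v x) = (LINT x|lebesgue. ?v (0 + (- 1) * x))"
    by (subst lebesgue_integral_real_affine[of "- 1" _ 0]) auto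
  also have "(LINT x|lebesgue. ?u x) + \<dots> = (LINT x|lebesgue. ?u x + ?v (0 + (- 1) * x))"
    by (rule Bochner_Integration.integral_add[OF u v', symmetric])
  also have "\<dots> = (LINT x:{0..}|lebesgue. h x)"
    unfolding set_lebesgue_integral_def
    by (intro Bochner_Integration.integral_cong) (auto simp: indicator_def h_def odd algebra_simps)
  finally show ?thesis .
qed

lemma h_zeros: "h (real k * p) = 0" "h ((real k + 1) * p) = 0" "h (real k * p + p / 2) = 0"
  using shift[of k 0] reflect[of k 0] shift[of k "p / 2"] by (simp_all add: h_def zero half)

text \<open>Cut the period at its midpoint, translate the first half by \<open>k * p\<close> and
  reflect the second half at \<open>(k + 1) * p\<close>. Both land on \<open>{0..p/2}\<close>, where
  \<open>\<psi>\<close> has become \<open>\<psi> x\<close> and \<open>- \<psi> x\<close>.\<close>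

lemma integral_period:
  "(LINT x:{real k * p..<(real k + 1) * p}|lebesgue. h x)
     = (LINT x:{0..p/2}|lebesgue. of_real (\<psi> x) * folded_term p g k x)"
proof -
  let ?u = "\<lambda>x. indicator {real k * p..real k * p + p / 2} x *\<^sub>R h x"
  let ?v = "\<lambda>x. indicator {real k * p + p / 2..(real k + 1) * p} x *\<^sub>R h x"
  have u: "integrable lebesgue ?u" and v: "integrable lebesgue ?v"
    using h_integrable by (intro integrable_mult_indicator; simp)+
  have u': "integrable lebesgue (\<lambda>x. ?u (real k * p + 1 * x))"
    by (intro lebesgue_integrable_real_affine u) simp
  have v': "integrable lebesgue (\<lambda>x. ?v ((real k + 1) * p + (- 1) * x))"
    by (intro lebesgue_integrable_real_affine v) simp
  \<comment> \<open>The closed half-periods may overlap: \<open>h\<close> vanishes at their endpoints.\<close>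
  have "(LINT x:{real k * p..<(real k + 1) * p}|lebesgue. h x) = (LINT x|lebesgue. ?u x + ?v x)"
    unfolding set_lebesgue_integral_def
  proof (intro Bochner_Integration.integral_cong refl)
    fix x
    consider "x = real k * p + p / 2" | "x = (real k + 1) * p"
      | "x \<noteq> real k * p + p / 2" "x \<noteq> (real k + 1) * p" by blast
    thus "indicator {real k * p..<(real k + 1) * p} x *\<^sub>R h x = ?u x + ?v x"
    proof cases
      case 3
      thus ?thesis using p_pos by (auto simp: indicator_def algebra_simps)
    qed (simp_all only: h_zeros, simp_all)
  qed
  also have "\<dots> = (LINT x|lebesgue. ?u x) + (LINT x|lebesgue. ?v x)"
    by (rule Bochner_Integration.integral_add[OF u v])
  also have "(LINT x|lebesgue. ?u x) = (LINT x|lebesgue. ?u (real k * p + 1 * x))"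
    by (subst lebesgue_integral_real_affine[of 1 _ "real k * p"]) auto
  also have "(LINT x|lebesgue. ?v x) = (LINT x|lebesgue. ?v ((real k + 1) * p + (- 1) * x))"
    by (subst lebesgue_integral_real_affine[of "- 1" _ "(real k + 1) * p"]) auto
  also have "(LINT x|lebesgue. ?u (real k * p + 1 * x)) + \<dots>
      = (LINT x|lebesgue. ?u (real k * p + 1 * x) + ?v ((real k + 1) * p + (- 1) * x))"
    by (rule Bochner_Integration.integral_add[OF u' v', symmetric])
  also have "\<dots> = (LINT x:{0..p/2}|lebesgue. of_real (\<psi> x) * folded_term p g k x)"
    unfolding set_lebesgue_integral_def
  proof (intro Bochner_Integration.integral_cong refl)
    fix x
    have "h (real k * p + x) + h ((real k + 1) * p - x) = of_real (\<psi> x) * folded_term p g k x"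
      unfolding h_def shift reflect folded_term_def by (simp add: ring_distribs)
    moreover have "indicator {real k * p..real k * p + p / 2} (real k * p + x) = (indicator {0..p/2} x :: real)"
      by (simp add: indicator_def)
    moreover have "indicator {real k * p + p / 2..(real k + 1) * p} ((real k + 1) * p - x) = (indicator {0..p/2} x :: real)"
      by (auto simp: indicator_def distrib_right)
    ultimately show "?u (real k * p + 1 * x) + ?v ((real k + 1) * p + (- 1) * x)
        = indicator {0..p/2} x *\<^sub>R (of_real (\<psi> x) * folded_term p g k x)"
      by (simp flip: scaleR_add_right)
  qed
  finally show ?thesis .
qed

text \<open>The half-line is the disjoint union of half-open periods; the sum over them moves inside
  the integral because \<open>norm_folded_term\<close> provides a geometric majorant.\<close>

lemma integral_folded:
  "(LINT x|lebesgue. of_real (\<psi> x) * g x) = (LINT x:{0..p/2}|lebesgue. of_real (\<psi> x) * folded p g x)"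
proof -
  let ?A = "\<lambda>k. {real k * p..<(real k + 1) * p}"
  have Un: "(\<Union>k. ?A k) = {0..}"
  proof (intro equalityI subsetI)
    fix x assume x: "x \<in> {0::real..}"
    have "real (nat \<lfloor>x / p\<rfloor>) \<le> x / p" "x / p < real (nat \<lfloor>x / p\<rfloor>) + 1"
      using x p_pos by (simp_all add: of_nat_floor)
    hence "x \<in> ?A (nat \<lfloor>x / p\<rfloor>)" using p_pos by (simp add: field_simps)
    thus "x \<in> (\<Union>k. ?A k)" by blast
  qed (use p_pos in \<open>auto intro: order_trans[rotated]\<close>)
  have disj: "?A i \<inter> ?A j = {}" if "i \<noteq> j" for i j :: nat
  proof -
    have "i = j" if x: "x \<in> ?A i" "x \<in> ?A j" for x
    proof -
      have "real i < real j + 1" "real j < real i + 1"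
        using x p_pos order_le_less_trans mult_less_cancel_right_pos
        by (metis atLeastLessThan_iff)+
      thus ?thesis by linarith
    qed
    thus ?thesis using that by blast
  qed
  have "(LINT x|lebesgue. of_real (\<psi> x) * g x) = (LINT x:(\<Union>k. ?A k)|lebesgue. h x)"
    by (simp only: integral_half_line Un)
  also have "\<dots> = (\<Sum>k. LINT x:?A k|lebesgue. h x)"
  proof (rule lebesgue_integral_countable_add)
    show "set_integrable lebesgue (\<Union>k. ?A k) h"
      unfolding Un set_integrable_def using h_integrable by (intro integrable_mult_indicator) auto
  qed (use disj in auto)
  also have "\<dots> = (\<Sum>k. LINT x|lebesgue. indicator {0..p/2} x *\<^sub>R (of_real (\<psi> x) * folded_term p g k x))"
    by (simp only: integral_period[unfolded set_lebesgue_integral_def] set_lebesgue_integral_def)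
  also have "\<dots> = (LINT x|lebesgue. (\<Sum>k. indicator {0..p/2} x *\<^sub>R (of_real (\<psi> x) * folded_term p g k x)))"
  proof (rule integral_suminf[symmetric])
    let ?f = "\<lambda>k x. indicator {0..p/2} x *\<^sub>R (of_real (\<psi> x) * folded_term p g k x)"
    have ft[measurable]: "folded_term p g k \<in> borel_measurable lebesgue" for k
      by (rule borel_measurable_lebesgue_continuous[OF folded_term_continuous])
    \<comment> \<open>Keeping the indicator in the majorant makes it integrable over the line, and
      the same geometric series serves both summability conditions.\<close>
    have bnd: "norm (?f k x) \<le> indicator {0..p/2} x * (M * (4 * C * exp (- p) ^ k))" for k x
      using mult_mono[OF bounded[of x] norm_folded_term[OF p_pos, of x k]] M_nonneg
      by (auto simp: indicator_def norm_mult)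
    have ii: "integrable lebesgue (\<lambda>x. indicator {0..p/2} x * (M * (4 * C * exp (- p) ^ k)))" for k :: nat
      by (intro integrable_mult_left) (simp add: integrable_indicator_iff emeasure_lborel_Icc_eq)
    show int: "integrable lebesgue (?f k)" for k
    proof (rule Bochner_Integration.integrable_bound[OF ii[of k]])
      show "?f k \<in> borel_measurable lebesgue" using meas ft[of k]
        by (intro borel_measurable_scaleR borel_measurable_indicator borel_measurable_times
              borel_measurable_of_real) auto
      show "AE x in lebesgue. norm (?f k x) \<le> norm (indicator {0..p/2} x * (M * (4 * C * exp (- p) ^ k)))"
        by (rule AE_I2, unfold real_norm_def) (rule order_trans[OF bnd abs_ge_self])
    qed
    have s: "summable (\<lambda>k. M * (4 * C * exp (- p) ^ k))"
      by (intro summable_mult summable_majorant p_pos)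
    show "AE x in lebesgue. summable (\<lambda>k. norm (?f k x))"
    proof (rule AE_I2)
      fix x
      have "summable (\<lambda>k. indicator {0..p/2} x * (M * (4 * C * exp (- p) ^ k)))"
        by (intro summable_mult s)
      thus "summable (\<lambda>k. norm (?f k x))"
        by (rule summable_comparison_test'[where N = 0]) (use bnd in auto)
    qed
    have "norm (LINT x|lebesgue. norm (?f k x)) \<le> p / 2 * (M * (4 * C * exp (- p) ^ k))" for k
    proof -
      have "(LINT x|lebesgue. norm (?f k x)) \<le> (LINT x|lebesgue. indicator {0..p/2} x * (M * (4 * C * exp (- p) ^ k)))"
        by (intro integral_mono integrable_norm int ii bnd)
      also have "\<dots> = p / 2 * (M * (4 * C * exp (- p) ^ k))"
        using p_pos by simp
      finally show ?thesis by simp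
    qed
    thus "summable (\<lambda>k. LINT x|lebesgue. norm (?f k x))"
      by (intro summable_comparison_test'[OF summable_mult[OF s, of "p / 2"], where N = 0]) auto
  qed
  also have "\<dots> = (LINT x:{0..p/2}|lebesgue. of_real (\<psi> x) * folded p g x)"
    unfolding set_lebesgue_integral_def
  proof (intro Bochner_Integration.integral_cong refl)
    fix x
    show "(\<Sum>k. indicator {0..p/2} x *\<^sub>R (of_real (\<psi> x) * folded_term p g k x))
        = indicator {0..p/2} x *\<^sub>R (of_real (\<psi> x) * folded p g x)"
    proof (cases "x \<in> {0..p/2}")
      case True
      have "summable (\<lambda>k. folded_term p g k x)"
        by (rule summable_comparison_test'[OF summable_majorant[OF p_pos], where N = 0])
           (use norm_folded_term[OF p_pos True] in auto)
      thus ?thesis using True by (simp add: folded_def suminf_mult)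
    qed simp
  qed
  finally show ?thesis .
qed

end

section \<open>Fourier transform of the kernel\<close>

text \<open>The endpoints are the neighbouring zeros. Halved imaginary parts of points of the region
  around the contour fall into this interval.\<close>

lemma cos_eq_0_range: "cos y = 0 \<Longrightarrow> - pi / 2 < y \<Longrightarrow> y < 3 * pi / 2 \<Longrightarrow> y = pi / 2" for y :: real
  using sin_eq_0_pi[of "y - pi / 2"] by (simp add: sin_diff)

lemma cosh_eq_0_imp: "cosh z = 0 \<Longrightarrow> Re z = 0 \<and> cos (Im z) = 0" for z :: complex
  using norm_cosh_squared[of z] by (simp add: sum_power2_eq_zero_iff)

text \<open>Each \<open>cosh\<close> factor changes sign under a shift by \<open>\<i> * pi\<close>
  of its argument, and the two signs cancel.\<close>

lemma strip_kernel_plus_2pi: "strip_kernel w (z + 2 * of_real pi * \<i>) = strip_kernel w z"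
proof -
  have "cosh (u + of_real pi * \<i>) = - cosh u" "cosh (u - of_real pi * \<i>) = - cosh u" for u :: complex
    by (simp_all add: cosh_Complex complex_eq_iff)
  from this(1)[of "z / 2"] this(2)[of "(w - z) / 2"] show ?thesis
    by (simp add: strip_kernel_def field_simps)
qed

text \<open>The residue theorem on the rectangle with base \<open>{-R..R}\<close> and height
  \<open>2 * pi\<close>. The left side is what remains after the horizontal sides and the residues
  are collected, the right side estimates the two vertical sides.
  \<open>R > \<bar>Re w\<bar>\<close> puts the pole \<open>w + \<i> * pi\<close> inside;
  \<open>w \<noteq> 0\<close> keeps the two poles apart, hence simple.\<close>

lemma strip_kernel_contour:
  fixes s R :: real and w :: complex and f :: "complex \<Rightarrow> complex"
  defines "f \<equiv> \<lambda>z::complex. exp (\<i> * of_real s * z) * strip_kernel w z"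
  assumes w: "w \<in> strip" "w \<noteq> 0" and R: "R > \<bar>Re w\<bar>"
  shows "norm ((1 - exp (- 2 * pi * s)) * integral {-R..R} (\<lambda>x. f (of_real x))
          - 4 * pi * \<i> * exp (- pi * s) * (1 - exp (\<i> * s * w)))
        \<le> 4 * pi * (exp (2 * pi * \<bar>s\<bar>) * norm (sinh (w / 2)) / (sinh (R / 2) * sinh ((R - \<bar>Re w\<bar>) / 2)))"
proof -
  \<comment> \<open>Largest margin by which the closed rectangle can be widened vertically without
    reaching further poles: the next ones are \<open>- \<i> * pi\<close>,
    \<open>3 * \<i> * pi\<close>, \<open>w - \<i> * pi\<close> and
    \<open>w + 3 * \<i> * pi\<close>.\<close>
  define \<epsilon> where "\<epsilon> = pi - \<bar>Im w\<bar>"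
  define U where "U = {z. - \<epsilon> < Im z \<and> Im z < 2 * pi + \<epsilon>}"
  define P where "P = {\<i> * pi, w + \<i> * pi}"
  have \<epsilon>: "\<epsilon> > 0" using w by (auto simp: \<epsilon>_def strip_def)
  have U: "open U" "connected U"
  proof -
    have eq: "U = {z. - \<epsilon> < Im z} \<inter> {z. Im z < 2 * pi + \<epsilon>}" by (auto simp: U_def)
    show "open U" unfolding eq by (intro open_Int open_halfspace_Im_gt open_halfspace_Im_lt)
    show "connected U" unfolding eq
      by (intro convex_connected convex_Int convex_halfspace_Im_gt convex_halfspace_Im_lt)
  qed
  define d where "d = (\<lambda>z. cosh (z / 2) * cosh ((w - z) / 2))"
  define g where "g = (\<lambda>z. exp (\<i> * of_real s * z) * sinh (w / 2))"
  have f_eq: "f = (\<lambda>z. g z / d z)" by (simp add: f_def g_def d_def strip_kernel_def)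
  have PU: "P \<subseteq> U" using \<epsilon> w by (auto simp: P_def U_def \<epsilon>_def strip_def)
  have d_zero: "z \<in> P" if z: "z \<in> U" "d z = 0" for z
  proof -
    consider "cosh (z / 2) = 0" | "cosh ((w - z) / 2) = 0" using z by (auto simp: d_def)
    thus ?thesis
    proof cases
      case 1
      from cosh_eq_0_imp[OF this] have "Re z = 0" "cos (Im z / 2) = 0" by auto
      moreover from this(2) have "Im z / 2 = pi / 2"
        by (rule cos_eq_0_range) (use z \<epsilon> in \<open>auto simp: U_def \<epsilon>_def\<close>)
      ultimately show ?thesis by (simp add: P_def complex_eq_iff)
    next
      case 2
      from cosh_eq_0_imp[OF this] have "Re z = Re w" "cos (Im ((w - z) / 2)) = 0" by auto
      moreover from this(2) have "cos ((Im z - Im w) / 2) = 0"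
        by (subst cos_minus[symmetric]) (simp add: minus_divide_left)
      hence "(Im z - Im w) / 2 = pi / 2"
        by (rule cos_eq_0_range) (use z \<epsilon> in \<open>auto simp: U_def \<epsilon>_def\<close>)
      ultimately show ?thesis by (simp add: P_def complex_eq_iff)
    qed
  qed
  have g_holo: "g holomorphic_on A" for A unfolding g_def by (intro holomorphic_intros)
  have d_holo: "d holomorphic_on A" for A unfolding d_def cosh_field_def by (intro holomorphic_intros) auto
  have f_holo: "f holomorphic_on U - P"
    unfolding f_eq by (intro holomorphic_on_divide g_holo d_holo) (use d_zero in auto)
  have cs: "cosh (\<i> * of_real pi / 2) = 0" "sinh (\<i> * of_real pi / 2) = \<i>"
    by (simp_all add: complex_eq_iff cosh_def sinh_def Re_exp Im_exp)
  \<comment> \<open>Adding \<open>\<i> * pi / 2\<close> turns a zero of \<open>sinh\<close> into a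
    zero of \<open>cosh\<close>, whose location is known.\<close>
  have sw: "sinh (w / 2) \<noteq> 0"
  proof
    assume "sinh (w / 2) = 0"
    hence "cosh (w / 2 + \<i> * of_real pi / 2) = 0" using cs by (simp add: cosh_add)
    from cosh_eq_0_imp[OF this] have *: "Re w = 0" "cos (Im w / 2 + pi / 2) = 0" by auto
    from *(2) have "Im w / 2 + pi / 2 = pi / 2"
      by (rule cos_eq_0_range) (use w in \<open>auto simp: strip_def\<close>)
    with * w show False by (simp add: complex_eq_iff)
  qed
  have g_nz: "g z \<noteq> 0" for z using sw by (simp add: g_def)
  have d_deriv: "(d has_field_derivative (sinh (z / 2) * cosh ((w - z) / 2) - cosh (z / 2) * sinh ((w - z) / 2)) / 2) (at z)" for z
    unfolding d_def by (auto intro!: derivative_eq_intros simp: field_simps)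
  have w1: "cosh ((w - \<i> * pi) / 2) = - \<i> * sinh (w / 2)"
    using cs by (simp add: diff_divide_distrib cosh_diff)
  have w2: "cosh ((w + \<i> * pi) / 2) = \<i> * sinh (w / 2)"
    using cs by (simp add: add_divide_distrib cosh_add)
  have w3: "cosh ((w - (w + \<i> * pi)) / 2) = 0" "sinh ((w - (w + \<i> * pi)) / 2) = - \<i>"
    using cs by simp_all
  \<comment> \<open>At the two poles the derivative of \<open>d\<close> is
    \<open>sinh (w / 2) / 2\<close> and its negative, so the factor \<open>sinh (w / 2)\<close> of
    \<open>g\<close> cancels.\<close>
  have res1: "residue f (\<i> * pi) = 2 * exp (- pi * s)"
  proof -
    have "residue f (\<i> * pi) = g (\<i> * pi) / (sinh (w / 2) / 2)"
      unfolding f_eq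
    proof (rule residue_simple_pole_deriv[OF g_holo d_holo U])
      show "(d has_field_derivative sinh (w / 2) / 2) (at (\<i> * pi))"
        using d_deriv[of "\<i> * pi"] by (simp add: cs w1)
      show "d (\<i> * pi) = 0" by (simp add: d_def cs)
    qed (use PU sw g_nz in \<open>auto simp: P_def\<close>)
    thus ?thesis using sw by (simp add: g_def mult_ac flip: exp_of_real)
  qed
  have res2: "residue f (w + \<i> * pi) = - 2 * exp (- pi * s) * exp (\<i> * s * w)"
  proof -
    have "residue f (w + \<i> * pi) = g (w + \<i> * pi) / (- sinh (w / 2) / 2)"
      unfolding f_eq
    proof (rule residue_simple_pole_deriv[OF g_holo d_holo U])
      show "(d has_field_derivative - sinh (w / 2) / 2) (at (w + \<i> * pi))"
        using d_deriv[of "w + \<i> * pi"] by (simp only: w2 w3) (simp add: mult_ac)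
      show "d (w + \<i> * pi) = 0" unfolding d_def w3 by simp
    qed (use PU sw g_nz in \<open>auto simp: P_def\<close>)
    moreover have "exp (\<i> * s * (w + \<i> * pi)) = exp (- pi * s) * exp (\<i> * s * w)"
      by (simp add: algebra_simps flip: exp_of_real exp_add)
    ultimately show ?thesis using sw by (simp add: g_def mult_ac)
  qed
  define a1 a2 a3 a4 where "a1 = Complex (-R) 0" and "a2 = Complex R 0"
    and "a3 = Complex R (2 * pi)" and "a4 = Complex (-R) (2 * pi)"
  have R0: "R > 0" using R by linarith
  have rect: "rectpath a1 a3 = linepath a1 a2 +++ linepath a2 a3 +++ linepath a3 a4 +++ linepath a4 a1"
    by (simp add: rectpath_def Let_def a1_def a2_def a3_def a4_def)
  have PB: "P \<subseteq> box a1 a3"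
    using R w by (auto simp: P_def a1_def a3_def in_box_complex_iff strip_def)
  have cU: "cbox a1 a3 \<subseteq> U"
    using \<epsilon> by (auto simp: U_def a1_def a3_def in_cbox_complex_iff)
  have imgU: "path_image (rectpath a1 a3) \<subseteq> U - P"
    using path_image_rectpath_cbox_minus_box[of a1 a3] R0 PB cU by (auto simp: a1_def a3_def)
  have ne: "\<i> * pi \<noteq> w + \<i> * pi" using w by simp
  have main: "contour_integral (rectpath a1 a3) f = 4 * pi * \<i> * exp (- pi * s) * (1 - exp (\<i> * s * w))"
  proof -
    have "contour_integral (rectpath a1 a3) f
        = 2 * pi * \<i> * (\<Sum>p\<in>P. winding_number (rectpath a1 a3) p * residue f p)"
    proof (rule Residue_theorem[OF U _ f_holo _ _ imgU])
      show "\<forall>z. z \<notin> U \<longrightarrow> winding_number (rectpath a1 a3) z = 0"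
        using cU R0 by (intro allI impI winding_number_rectpath_outside) (auto simp: a1_def a3_def)
    qed (auto simp: P_def)
    also have "(\<Sum>p\<in>P. winding_number (rectpath a1 a3) p * residue f p) = (\<Sum>p\<in>P. residue f p)"
      using PB by (intro sum.cong) (auto simp: winding_number_rectpath)
    also have "\<dots> = residue f (\<i> * pi) + residue f (w + \<i> * pi)"
      unfolding P_def using ne by simp
    finally show ?thesis by (simp only: res1 res2) (simp add: algebra_simps)
  qed
  have f_cont: "continuous_on (path_image (rectpath a1 a3)) f"
    using holomorphic_on_subset[OF f_holo imgU] by (rule holomorphic_on_imp_continuous_on)
  have img: "path_image (rectpath a1 a3) = closed_segment a1 a2 \<union> closed_segment a2 a3 \<union> closed_segment a3 a4 \<union> closed_segment a4 a1"
    by (simp add: rect path_image_join Un_assoc)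
  have ci: "f contour_integrable_on linepath a1 a2" "f contour_integrable_on linepath a2 a3"
    "f contour_integrable_on linepath a3 a4" "f contour_integrable_on linepath a4 a1"
    by (intro contour_integrable_continuous_linepath continuous_on_subset[OF f_cont]; use img in blast)+
  have split: "contour_integral (rectpath a1 a3) f = contour_integral (linepath a1 a2) f
      + contour_integral (linepath a2 a3) f + contour_integral (linepath a3 a4) f + contour_integral (linepath a4 a1) f"
    unfolding rect using ci by (simp add: algebra_simps)
  have bot: "contour_integral (linepath a1 a2) f = integral {-R..R} (\<lambda>x. f (of_real x))"
    using R0 by (subst contour_integral_linepath_Reals_eq) (auto simp: a1_def a2_def complex_is_Real_iff)
  \<comment> \<open>The shift by \<open>2 * pi * \<i>\<close> changes only the exponential factor;
    the minus sign is the reversed orientation.\<close>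
  have top: "contour_integral (linepath a3 a4) f = - exp (- 2 * pi * s) * contour_integral (linepath a1 a2) f"
  proof -
    have *: "f (z + 2 * of_real pi * \<i>) = exp (- 2 * pi * s) * f z" for z
      unfolding f_def strip_kernel_plus_2pi
      by (simp add: algebra_simps flip: exp_of_real exp_add)
    have "contour_integral (linepath a3 a4) f = - contour_integral (linepath a4 a3) f"
      using contour_integral_reversepath[of "linepath a4 a3" f] by simp
    also have "contour_integral (linepath a4 a3) f = integral {0..1} (\<lambda>x. f (linepath a4 a3 x) * (a3 - a4))"
      by (simp add: contour_integral_integral)
    also have "\<dots> = integral {0..1} (\<lambda>x. exp (- 2 * pi * s) * (f (linepath a1 a2 x) * (a2 - a1)))"
    proof (rule integral_cong)
      fix x :: real
      have "linepath a4 a3 x = linepath a1 a2 x + 2 * of_real pi * \<i>" "a3 - a4 = a2 - a1"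
        by (simp_all add: linepath_def a1_def a2_def a3_def a4_def complex_eq_iff algebra_simps)
      thus "f (linepath a4 a3 x) * (a3 - a4) = exp (- 2 * pi * s) * (f (linepath a1 a2 x) * (a2 - a1))"
        by (simp only: *) (simp add: mult_ac)
    qed
    also have "\<dots> = exp (- 2 * pi * s) * contour_integral (linepath a1 a2) f"
      by (simp add: contour_integral_integral)
    finally show ?thesis by simp
  qed
  \<comment> \<open>The exponential is largest for \<open>Im z\<close> up to \<open>2 * pi\<close>;
    the denominators come from \<open>norm_cosh_ge_sinh\<close>, which ignores the imaginary part
    and so holds along the whole side.\<close>
  define M where "M = exp (2 * pi * \<bar>s\<bar>) * norm (sinh (w / 2)) / (sinh (R / 2) * sinh ((R - \<bar>Re w\<bar>) / 2))"
  have M0: "M \<ge> 0" unfolding M_def using R R0 by simp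
  have fM: "norm (f z) \<le> M" if z: "\<bar>Re z\<bar> = R" "0 \<le> Im z" "Im z \<le> 2 * pi" for z
  proof -
    have 1: "norm (exp (\<i> * of_real s * z)) \<le> exp (2 * pi * \<bar>s\<bar>)"
    proof -
      have "- (s * Im z) \<le> \<bar>s\<bar> * Im z" using z by (cases "s \<ge> 0") auto
      also have "\<dots> \<le> \<bar>s\<bar> * (2 * pi)" using z by (intro mult_left_mono) auto
      finally show ?thesis by (simp add: mult_ac)
    qed
    have 2: "sinh (R / 2) \<le> norm (cosh (z / 2))"
      using norm_cosh_ge_sinh[of "z / 2"] z R0 by (cases "Re z \<ge> 0") auto
    have 3: "sinh ((R - \<bar>Re w\<bar>) / 2) \<le> norm (cosh ((w - z) / 2))"
    proof -
      have "sinh ((R - \<bar>Re w\<bar>) / 2) \<le> sinh \<bar>Re ((w - z) / 2)\<bar>"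
        using z by (subst sinh_real_le_iff) (auto simp: abs_if field_simps split: if_splits)
      also have "\<dots> = \<bar>sinh (Re ((w - z) / 2))\<bar>"
        by (simp only: sinh_real_abs)
      also have "\<dots> \<le> norm (cosh ((w - z) / 2))" by (rule norm_cosh_ge_sinh)
      finally show ?thesis .
    qed
    have "norm (f z) = norm (exp (\<i> * of_real s * z)) * norm (sinh (w / 2)) / (norm (cosh (z / 2)) * norm (cosh ((w - z) / 2)))"
      unfolding f_def strip_kernel_def by (simp only: norm_mult norm_divide) simp
    also have "\<dots> \<le> M" unfolding M_def
      using 1 2 3 R R0 by (intro frac_le mult_mono mult_pos_pos mult_nonneg_nonneg) auto
    finally show ?thesis .
  qed
  have side: "norm (contour_integral (linepath a2 a3) f) \<le> M * (2 * pi)"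
    "norm (contour_integral (linepath a4 a1) f) \<le> M * (2 * pi)"
  proof -
    have "norm (contour_integral (linepath a2 a3) f) \<le> M * norm (a3 - a2)"
      by (rule contour_integral_bound_linepath[OF ci(2) M0 fM])
         (use R0 pi_gt_zero in \<open>auto simp: a2_def a3_def closed_segment_same_Re closed_segment_eq_real_ivl split: if_splits\<close>)
    moreover have "norm (contour_integral (linepath a4 a1) f) \<le> M * norm (a1 - a4)"
      by (rule contour_integral_bound_linepath[OF ci(4) M0 fM])
         (use R0 pi_gt_zero in \<open>auto simp: a1_def a4_def closed_segment_same_Re closed_segment_eq_real_ivl split: if_splits\<close>)
    moreover have "norm (a3 - a2) = 2 * pi" "norm (a1 - a4) = 2 * pi"
      by (simp_all add: a1_def a2_def a3_def a4_def cmod_def real_sqrt_mult)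
    ultimately show "norm (contour_integral (linepath a2 a3) f) \<le> M * (2 * pi)"
      "norm (contour_integral (linepath a4 a1) f) \<le> M * (2 * pi)" by simp_all
  qed
  have "(1 - exp (- 2 * pi * s)) * integral {-R..R} (\<lambda>x. f (of_real x))
          - 4 * pi * \<i> * exp (- pi * s) * (1 - exp (\<i> * s * w))
       = - (contour_integral (linepath a2 a3) f + contour_integral (linepath a4 a1) f)"
    using split unfolding main top bot by (simp add: algebra_simps)
  also have "norm \<dots> \<le> M * (2 * pi) + M * (2 * pi)"
    unfolding norm_minus_cancel by (intro norm_triangle_le add_mono side)
  finally show ?thesis by (simp add: M_def algebra_simps)
qed

text \<open>Dominated convergence with majorant \<open>norm (f x)\<close>. It links the contour
  estimate, stated for Henstock-Kurzweil integrals on bounded intervals, to the Lebesgue integral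
  over the line.\<close>

lemma integral_symmetric_interval_LIMSEQ:
  fixes f :: "real \<Rightarrow> complex"
  assumes f: "integrable lebesgue f"
  shows "(\<lambda>n. integral {- real n..real n} f) \<longlonglongrightarrow> (LINT x|lebesgue. f x)"
proof -
  have "(\<lambda>n. LINT x|lebesgue. indicator {- real n..real n} x *\<^sub>R f x) \<longlonglongrightarrow> (LINT x|lebesgue. f x)"
  proof (rule integral_dominated_convergence[where w = "\<lambda>x. norm (f x)"])
    show "AE x in lebesgue. (\<lambda>n. indicator {- real n..real n} x *\<^sub>R f x) \<longlonglongrightarrow> f x"
    proof (rule AE_I2)
      fix x :: real
      obtain N where N: "\<bar>x\<bar> \<le> real N" using real_arch_simple by blast
      have "eventually (\<lambda>n. indicator {- real n..real n} x *\<^sub>R f x = f x) sequentially"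
        using eventually_ge_at_top[of N]
      proof eventually_elim
        case (elim n)
        hence "\<bar>x\<bar> \<le> real n" using N by linarith
        thus ?case by (simp add: abs_le_iff)
      qed
      thus "(\<lambda>n. indicator {- real n..real n} x *\<^sub>R f x) \<longlonglongrightarrow> f x"
        by (rule tendsto_eventually)
    qed
    show "(\<lambda>x. indicator {- real n..real n} x *\<^sub>R f x) \<in> borel_measurable lebesgue" for n
      by (intro borel_measurable_integrable integrable_mult_indicator f) auto
  qed (use f in \<open>auto simp: indicator_def\<close>)
  moreover have "(LINT x|lebesgue. indicator {- real n..real n} x *\<^sub>R f x) = integral {- real n..real n} f" for n
    using set_lebesgue_integral_eq_integral(2)[of "{- real n..real n}" f] f
    by (simp add: set_lebesgue_integral_def set_integrable_def integrable_mult_indicator)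
  ultimately show ?thesis by simp
qed

lemma exp_decaying_strip_kernel:
  assumes "w \<in> strip"
  obtains C where "exp_decaying (\<lambda>x. strip_kernel w (of_real x)) C"
  using norm_strip_kernel_le[OF assms] continuous_on_strip_kernel[OF assms]
  unfolding exp_decaying_def by metis

lemma integrable_mult_strip_kernel:
  fixes \<phi> :: "real \<Rightarrow> complex"
  assumes w: "w \<in> strip" and \<phi>: "\<phi> \<in> borel_measurable lebesgue" "\<And>x. norm (\<phi> x) \<le> M"
  shows "integrable lebesgue (\<lambda>x. \<phi> x * strip_kernel w (of_real x))"
proof -
  obtain C where "exp_decaying (\<lambda>x. strip_kernel w (of_real x)) C"
    using exp_decaying_strip_kernel[OF w] .
  then interpret exp_decaying "\<lambda>x. strip_kernel w (of_real x)" C .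
  have m: "(\<lambda>x. strip_kernel w (of_real x)) \<in> borel_measurable lebesgue"
    by (rule borel_measurable_lebesgue_continuous[OF cont])
  have M: "M \<ge> 0" using order_trans[OF norm_ge_zero \<phi>(2)] .
  show ?thesis
  proof (rule integrable_exp_bound)
    show "norm (\<phi> x * strip_kernel w (of_real x)) \<le> (M * C) * exp (- \<bar>x\<bar>)" for x
      using mult_mono[OF \<phi>(2)[of x] decay[of x]] M by (simp add: norm_mult mult_ac)
  qed (use m \<phi>(1) in measurable)
qed

text \<open>As \<open>R\<close> grows the vertical sides vanish, and the factor
  \<open>1 - exp (- 2 * pi * s)\<close>, nonzero because \<open>s \<noteq> 0\<close>, can be divided
  out.\<close>

lemma strip_kernel_fourier_exp:
  fixes s :: real
  assumes w: "w \<in> strip" and s: "s \<noteq> 0"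
  shows "(LINT x|lebesgue. exp (\<i> * of_real s * of_real x) * strip_kernel w (of_real x))
           = 2 * of_real pi * \<i> * (1 - exp (\<i> * of_real s * w)) / of_real (sinh (pi * s))"
proof (cases "w = 0")
  case True
  thus ?thesis by (simp add: strip_kernel_def)
next
  case False
  define f where "f = (\<lambda>z. exp (\<i> * of_real s * z) * strip_kernel w z)"
  define q r where "q = complex_of_real (1 - exp (- 2 * pi * s))"
    and "r = 4 * of_real pi * \<i> * of_real (exp (- pi * s)) * (1 - exp (\<i> * of_real s * w))"
  have int: "integrable lebesgue (\<lambda>x. f (of_real x))"
    unfolding f_def
    by (intro integrable_mult_strip_kernel[OF w, where M = 1] borel_measurable_lebesgue_continuous continuous_intros)
       simp
  let ?K = "exp (2 * pi * \<bar>s\<bar>) * norm (sinh (w / 2))"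
  let ?b = "\<lambda>n. 4 * pi * (?K / (sinh (real n / 2) * sinh ((real n - \<bar>Re w\<bar>) / 2)))"
  have "(\<lambda>n. q * integral {- real n..real n} (\<lambda>x. f (of_real x)) - r) \<longlonglongrightarrow> 0"
  proof (rule Lim_null_comparison)
    show "eventually (\<lambda>n. norm (q * integral {- real n..real n} (\<lambda>x. f (of_real x)) - r) \<le> ?b n) sequentially"
      using eventually_gt_at_top[of "nat \<lceil>\<bar>Re w\<bar>\<rceil>"]
    proof eventually_elim
      case (elim n)
      hence "real n > \<bar>Re w\<bar>" by linarith
      from strip_kernel_contour[OF w False this, of s] show ?case
        by (simp add: f_def q_def r_def)
    qed
    have "filterlim (\<lambda>n. sinh (real n / 2)) at_top sequentially"
      by (rule filterlim_compose[OF sinh_real_at_top]) real_asymp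
    moreover have "filterlim (\<lambda>n. sinh ((real n - \<bar>Re w\<bar>) / 2)) at_top sequentially"
      by (rule filterlim_compose[OF sinh_real_at_top]) real_asymp
    ultimately have "filterlim (\<lambda>n. sinh (real n / 2) * sinh ((real n - \<bar>Re w\<bar>) / 2)) at_top sequentially"
      by (rule filterlim_at_top_mult_at_top)
    hence "(\<lambda>n. ?K / (sinh (real n / 2) * sinh ((real n - \<bar>Re w\<bar>) / 2))) \<longlonglongrightarrow> 0"
      by (intro tendsto_divide_0[OF tendsto_const] filterlim_at_top_imp_at_infinity)
    from tendsto_mult_left[OF this, of "4 * pi"] show "?b \<longlonglongrightarrow> 0" by simp
  qed
  moreover have "(\<lambda>n. q * integral {- real n..real n} (\<lambda>x. f (of_real x)) - r)
      \<longlonglongrightarrow> q * (LINT x|lebesgue. f (of_real x)) - r"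
    by (intro tendsto_intros integral_symmetric_interval_LIMSEQ int)
  ultimately have "q * (LINT x|lebesgue. f (of_real x)) - r = 0"
    by (rule LIMSEQ_unique[symmetric])
  moreover have q: "q = of_real (2 * exp (- pi * s) * sinh (pi * s))"
    unfolding q_def of_real_eq_iff by (simp add: sinh_def algebra_simps flip: exp_add)
  moreover have "of_real (exp (- pi * s)) \<noteq> (0 :: complex)" "of_real (sinh (pi * s)) \<noteq> (0 :: complex)"
    using s by simp_all
  ultimately have "(LINT x|lebesgue. f (of_real x)) = 2 * of_real pi * \<i> * (1 - exp (\<i> * of_real s * w)) / of_real (sinh (pi * s))"
    unfolding r_def of_real_mult by (simp add: divide_simps) (simp add: algebra_simps)
  thus ?thesis by (simp only: f_def)
qed

text \<open>The sine is a difference of exponentials at \<open>s\<close> and \<open>- s\<close>.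
  Since \<open>sinh\<close> is odd, the two transforms combine with equal signs and the exponentials
  in \<open>w\<close> add up to a cosine.\<close>

lemma strip_kernel_fourier_sin:
  fixes s :: real
  assumes w: "w \<in> strip" and s: "s \<noteq> 0"
  shows "(LINT x|lebesgue. of_real (sin (s * x)) * strip_kernel w (of_real x))
           = 2 * of_real pi * ((1 - cos (of_real s * w)) / of_real (sinh (pi * s)))"
proof -
  let ?e = "\<lambda>t x. exp (\<i> * of_real t * of_real x) * strip_kernel w (of_real x)"
  have int: "integrable lebesgue (?e t)" for t :: real
    by (intro integrable_mult_strip_kernel[OF w, where M = 1] borel_measurable_lebesgue_continuous continuous_intros)
       simp
  have "of_real (sin (s * x)) * strip_kernel w (of_real x) = (?e s x - ?e (- s) x) / (2 * \<i>)" for x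
    by (simp add: sin_exp_eq field_simps flip: sin_of_real)
  hence "(LINT x|lebesgue. of_real (sin (s * x)) * strip_kernel w (of_real x))
      = ((LINT x|lebesgue. ?e s x) - (LINT x|lebesgue. ?e (- s) x)) / (2 * \<i>)"
    using int by (simp only: integral_divide_zero Bochner_Integration.integral_diff)
  also have "\<dots> = 2 * of_real pi * ((1 - cos (of_real s * w)) / of_real (sinh (pi * s)))"
    using s strip_kernel_fourier_exp[OF w, of s] strip_kernel_fourier_exp[OF w, of "- s"]
    by (simp only: neg_equal_0_iff_equal simp_thms) (simp add: cos_exp_eq divide_simps, simp add: algebra_simps)
  finally show ?thesis .
qed

section \<open>Sine series on half a period\<close>

text \<open>Substituting \<open>t = cos (a * x)\<close> turns the problem into one about
  polynomials: \<open>f x * sin (a * x)\<close> is orthogonal to every polynomial in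
  \<open>cos (a * x)\<close>, and by Weierstrass those approximate it uniformly.\<close>

lemma sine_coefficients_unique:
  fixes f :: "real \<Rightarrow> real" and a :: real
  assumes a: "a > 0" and f: "continuous_on {0..pi / a} f"
    and orth: "\<And>n. n \<ge> 1 \<Longrightarrow> integral {0..pi / a} (\<lambda>x. f x * sin (a * real n * x)) = 0"
    and x: "0 < x" "x < pi / a"
  shows "f x = 0"
proof -
  let ?I = "{0..pi / a}"
  \<comment> \<open>Multiplying by \<open>cos (a * x)\<close> moves the frequency to
    \<open>n + 1\<close> and \<open>n - 1\<close>, so the induction on \<open>k\<close> keeps
    \<open>n\<close> arbitrary; it includes \<open>n = 0\<close>, reached from 1, where the sine is
    zero.\<close>
  have mom: "integral ?I (\<lambda>x. f x * sin (a * real n * x) * cos (a * x) ^ k) = 0" for n k :: nat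
  proof (induction k arbitrary: n)
    case 0
    show ?case using orth[of n] by (cases "n = 0") auto
  next
    case (Suc k)
    show ?case
    proof (cases "n = 0")
      case False
      let ?g = "\<lambda>m x. f x * sin (a * real m * x) * cos (a * x) ^ k"
      have int: "?g m integrable_on ?I" for m
        by (intro integrable_continuous_real continuous_intros f)
      have eq: "sin (a * real n * x) * cos (a * x) = (sin (a * real (n + 1) * x) + sin (a * real (n - 1) * x)) / 2" for x
        using False by (simp add: of_nat_diff algebra_simps sin_add sin_diff)
      have "f x * sin (a * real n * x) * cos (a * x) ^ Suc k = (?g (n + 1) x + ?g (n - 1) x) / 2" for x
      proof -
        have "f x * sin (a * real n * x) * cos (a * x) ^ Suc k = f x * (sin (a * real n * x) * cos (a * x)) * cos (a * x) ^ k"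
          by (simp only: power_Suc mult.assoc)
        thus ?thesis
          unfolding eq by (simp only: distrib_left distrib_right times_divide_eq_right times_divide_eq_left)
      qed
      hence "integral ?I (\<lambda>x. f x * sin (a * real n * x) * cos (a * x) ^ Suc k)
          = (integral ?I (?g (n + 1)) + integral ?I (?g (n - 1))) / 2"
        using int[of "n + 1"] int[of "n - 1"] by (simp only: integral_divide Henstock_Kurzweil_Integration.integral_add)
      thus ?thesis by (simp only: Suc.IH) simp
    qed simp
  qed
  define h where "h = (\<lambda>x. f x * sin (a * x))"
  have h: "continuous_on ?I h" unfolding h_def by (intro continuous_intros f)
  define e where "e = (\<lambda>t. h (arccos t / a))"
  have e: "continuous_on {-1..1} e"
    unfolding e_def
    by (rule continuous_on_compose2[OF h])
       (use a arccos_lbound arccos_ubound in \<open>auto intro!: continuous_intros divide_right_mono\<close>)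
  have eh: "e (cos (a * x)) = h x" if "x \<in> ?I" for x
    using that a by (simp add: e_def arccos_cos field_simps)
  have h2_cont: "continuous_on ?I (\<lambda>x. h x * h x)" and habs_cont: "continuous_on ?I (\<lambda>x. \<bar>h x\<bar>)"
    by (intro continuous_intros h)+
  \<comment> \<open>As \<open>h\<close> is orthogonal to the approximating polynomial
    \<open>g (cos (a * x))\<close>, the integral of \<open>h * h\<close> equals that of
    \<open>h\<close> times the approximation error.\<close>
  have small: "integral ?I (\<lambda>x. h x * h x) \<le> d * integral ?I (\<lambda>x. \<bar>h x\<bar>)" if "d > 0" for d
  proof -
    obtain g where "real_polynomial_function g" and g: "\<And>t. t \<in> {-1..1} \<Longrightarrow> \<bar>e t - g t\<bar> < d"
      using Stone_Weierstrass_real_polynomial_function[OF compact_Icc e \<open>d > 0\<close>] by blast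
    then obtain c N where gc: "g = (\<lambda>t. \<Sum>i\<le>N. c i * t ^ i)"
      by (auto simp: real_polynomial_function_iff_sum)
    have g_cont: "continuous_on ?I (\<lambda>x. h x * g (cos (a * x)))"
      unfolding gc by (intro continuous_intros h)
    have "integral ?I (\<lambda>x. h x * g (cos (a * x)))
        = integral ?I (\<lambda>x. \<Sum>i\<le>N. c i * (f x * sin (a * real 1 * x) * cos (a * x) ^ i))"
      by (intro integral_cong) (simp add: gc h_def sum_distrib_left mult_ac)
    also have "\<dots> = (\<Sum>i\<le>N. c i * integral ?I (\<lambda>x. f x * sin (a * real 1 * x) * cos (a * x) ^ i))"
      by (subst integral_sum) (auto simp only: integral_mult_right finite_atMost intro!: integrable_continuous_real continuous_intros f)
    also have "\<dots> = 0" by (simp only: mom) simp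
    finally have g0: "integral ?I (\<lambda>x. h x * g (cos (a * x))) = 0" .
    have "integral ?I (\<lambda>x. h x * h x) = integral ?I (\<lambda>x. h x * h x - h x * g (cos (a * x)))"
      by (subst Henstock_Kurzweil_Integration.integral_diff)
         (auto simp: g0 intro!: integrable_continuous_real h2_cont g_cont)
    also have "\<dots> \<le> integral ?I (\<lambda>x. d * \<bar>h x\<bar>)"
    proof (rule integral_le)
      fix x assume x: "x \<in> ?I"
      have "h x * h x - h x * g (cos (a * x)) = h x * (e (cos (a * x)) - g (cos (a * x)))"
        using eh[OF x] by (simp add: algebra_simps)
      also have "\<dots> \<le> \<bar>h x\<bar> * \<bar>e (cos (a * x)) - g (cos (a * x))\<bar>"
        by (metis abs_ge_self abs_mult)
      also have "\<dots> \<le> \<bar>h x\<bar> * d"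
        using g[of "cos (a * x)"] by (intro mult_left_mono) auto
      finally show "h x * h x - h x * g (cos (a * x)) \<le> d * \<bar>h x\<bar>" by (simp add: mult_ac)
    qed (intro integrable_continuous_real continuous_intros h h2_cont g_cont)+
    finally show ?thesis by simp
  qed
  have "integral ?I (\<lambda>x. h x * h x) \<le> 0"
  proof (rule field_le_epsilon)
    fix \<epsilon> :: real assume "\<epsilon> > 0"
    define J where "J = integral ?I (\<lambda>x. \<bar>h x\<bar>)"
    have J: "J \<ge> 0" unfolding J_def by (intro Henstock_Kurzweil_Integration.integral_nonneg integrable_continuous_real habs_cont) auto
    \<comment> \<open>The denominator \<open>J + 1\<close> also covers \<open>J = 0\<close>.\<close>
    have "integral ?I (\<lambda>x. h x * h x) \<le> \<epsilon> / (J + 1) * J"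
      unfolding J_def by (rule small) (use J \<open>\<epsilon> > 0\<close> in \<open>auto simp: J_def[symmetric]\<close>)
    also have "\<dots> \<le> \<epsilon>" using J \<open>\<epsilon> > 0\<close> by (simp add: field_simps)
    finally show "integral ?I (\<lambda>x. h x * h x) \<le> 0 + \<epsilon>" by simp
  qed
  moreover have "integral ?I (\<lambda>x. h x * h x) \<ge> 0"
    by (intro Henstock_Kurzweil_Integration.integral_nonneg integrable_continuous_real h2_cont) auto
  ultimately have "\<forall>x\<in>?I. h x * h x = 0"
    using integral_eq_0_iff[OF h2_cont] a by simp
  \<comment> \<open>The weight vanishes at both endpoints, which is why the conclusion is confined
    to the open interval.\<close>
  moreover have "sin (a * x) > 0" using a x by (intro sin_gt_zero) (auto simp: field_simps)
  ultimately show ?thesis using x by (auto simp: h_def)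
qed

lemma sine_coefficients_unique_complex:
  fixes f g :: "real \<Rightarrow> complex" and a :: real
  assumes a: "a > 0" and f: "continuous_on {0..pi / a} f" and g: "continuous_on {0..pi / a} g"
    and eq: "\<And>n. n \<ge> 1 \<Longrightarrow> integral {0..pi / a} (\<lambda>x. of_real (sin (a * real n * x)) * f x)
                         = integral {0..pi / a} (\<lambda>x. of_real (sin (a * real n * x)) * g x)"
    and x: "0 < x" "x < pi / a"
  shows "f x = g x"
proof -
  have int: "(\<lambda>x. of_real (sin (a * real n * x)) * k x) integrable_on {0..pi / a}"
    if "continuous_on {0..pi / a} k" for n and k :: "real \<Rightarrow> complex"
    by (intro integrable_continuous_real continuous_intros that)
  have *: "((\<lambda>x. of_real (sin (a * real n * x)) * (f x - g x)) has_integral 0) {0..pi / a}" if "n \<ge> 1" for n :: nat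
    using has_integral_diff[OF integrable_integral[OF int[OF f, of n]] integrable_integral[OF int[OF g, of n]]]
    by (simp add: right_diff_distrib eq[OF that])
  have "Re (f x - g x) = 0"
  proof (rule sine_coefficients_unique[OF a _ _ x, of "\<lambda>x. Re (f x - g x)"])
    fix n :: nat assume "n \<ge> 1"
    from has_integral_linear[OF *[OF this] bounded_linear_Re]
    show "integral {0..pi / a} (\<lambda>x. Re (f x - g x) * sin (a * real n * x)) = 0"
      by (intro integral_unique) (simp add: o_def mult_ac)
  qed (intro continuous_intros f g)
  moreover have "Im (f x - g x) = 0"
  proof (rule sine_coefficients_unique[OF a _ _ x, of "\<lambda>x. Im (f x - g x)"])
    fix n :: nat assume "n \<ge> 1"
    from has_integral_linear[OF *[OF this] bounded_linear_Im]
    show "integral {0..pi / a} (\<lambda>x. Im (f x - g x) * sin (a * real n * x)) = 0"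
      by (intro integral_unique) (simp add: o_def mult_ac)
  qed (intro continuous_intros f g)
  ultimately show ?thesis by (simp add: complex_eq_iff)
qed

section \<open>Orthogonality of sines and termwise integration\<close>

lemma integral_cos_half_period:
  assumes a: "a > 0"
  shows "((\<lambda>x. cos (a * real_of_int j * x)) has_integral (if j = 0 then pi / a else 0)) {0..pi / a}"
proof (cases "j = 0")
  case True
  thus ?thesis using has_integral_const_real[of "1::real" 0 "pi / a"] a by simp
next
  case False
  have "((\<lambda>x. cos (a * real_of_int j * x)) has_integral
      (sin (a * real_of_int j * (pi / a)) / (a * real_of_int j) - sin (a * real_of_int j * 0) / (a * real_of_int j))) {0..pi / a}"
    by (rule fundamental_theorem_of_calculus)
       (use a False in \<open>auto intro!: derivative_eq_intros simp flip: has_real_derivative_iff_has_vector_derivative\<close>)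
  moreover have "sin (a * real_of_int j * (pi / a)) = 0"
    using a by (auto simp: sin_zero_iff_int2)
  ultimately show ?thesis using False by simp
qed

lemma sine_orthogonality:
  assumes a: "a > 0" and n: "n \<ge> 1"
  shows "integral {0..pi / a} (\<lambda>x. sin (a * real m * x) * sin (a * real n * x)) = (if m = n then pi / (2 * a) else 0)"
proof -
  have "sin (a * real m * x) * sin (a * real n * x)
      = (cos (a * real_of_int (int m - int n) * x) - cos (a * real_of_int (int m + int n) * x)) / 2" for x
    by (simp add: sin_times_sin algebra_simps)
  hence "((\<lambda>x. sin (a * real m * x) * sin (a * real n * x)) has_integral
      ((if int m - int n = 0 then pi / a else 0) - (if int m + int n = 0 then pi / a else 0)) / 2) {0..pi / a}"
    by (simp only:) (intro has_integral_divide has_integral_diff integral_cos_half_period a)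
  from integral_unique[OF this] show ?thesis using n by auto
qed

text \<open>The terms are dominated by \<open>M * norm (d k)\<close> on a bounded interval. It
  serves twice: with a sine for \<open>\<phi>\<close> it reads off the coefficients of a sine
  series, with \<open>\<psi>\<close> it yields the series for the integral transform.\<close>

lemma sums_integral_sine_series:
  fixes d :: "nat \<Rightarrow> complex" and \<phi> :: "real \<Rightarrow> real"
  assumes \<phi>: "\<phi> \<in> borel_measurable lebesgue" "\<And>x. \<bar>\<phi> x\<bar> \<le> M"
    and d: "summable (\<lambda>k. norm (d k))"
  shows "(\<lambda>k. d k * of_real (LINT x:{0..L}|lebesgue. \<phi> x * sin (a * real (Suc k) * x)))
     sums (LINT x:{0..L}|lebesgue. of_real (\<phi> x) * (\<Sum>k. d k * of_real (sin (a * real (Suc k) * x))))"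
proof -
  let ?s = "\<lambda>k x. sin (a * real (Suc k) * x)"
  let ?f = "\<lambda>k x. indicator {0..L} x *\<^sub>R (d k * of_real (\<phi> x * ?s k x))"
  have M: "M \<ge> 0" using order_trans[OF abs_ge_zero \<phi>(2)] .
  have sm: "?s k \<in> borel_measurable lebesgue" for k
    by (intro borel_measurable_lebesgue_continuous continuous_intros)
  have bnd: "norm (?f k x) \<le> indicator {0..L} x * (M * norm (d k))" for k x
  proof -
    have "\<bar>\<phi> x\<bar> * \<bar>?s k x\<bar> \<le> M * 1" using \<phi>(2)[of x] M by (intro mult_mono) auto
    from mult_left_mono[OF this norm_ge_zero[of "d k"]] show ?thesis
      by (auto simp: indicator_def norm_mult abs_mult mult_ac)
  qed
  have ii: "integrable lebesgue (\<lambda>x. indicator {0..L} x * (M * norm (d k)))" for k :: nat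
    by (intro integrable_mult_left) (simp add: integrable_indicator_iff emeasure_lborel_Icc_eq)
  have int: "integrable lebesgue (?f k)" for k
  proof (rule Bochner_Integration.integrable_bound[OF ii[of k]])
    show "?f k \<in> borel_measurable lebesgue" using \<phi>(1) sm[of k]
      by (intro borel_measurable_scaleR borel_measurable_indicator borel_measurable_times
            borel_measurable_of_real borel_measurable_const) auto
    show "AE x in lebesgue. norm (?f k x) \<le> norm (indicator {0..L} x * (M * norm (d k)))"
      by (rule AE_I2, unfold real_norm_def) (rule order_trans[OF bnd abs_ge_self])
  qed
  have s: "summable (\<lambda>k. M * norm (d k))" by (intro summable_mult d)
  have "(\<lambda>k. LINT x|lebesgue. ?f k x) sums (LINT x|lebesgue. (\<Sum>k. ?f k x))"
  proof (rule sums_integral[OF int])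
    show "AE x in lebesgue. summable (\<lambda>k. norm (?f k x))"
    proof (rule AE_I2)
      fix x
      have "summable (\<lambda>k. indicator {0..L} x * (M * norm (d k)))" by (intro summable_mult s)
      thus "summable (\<lambda>k. norm (?f k x))"
        by (rule summable_comparison_test'[where N = 0]) (use bnd in auto)
    qed
    have "norm (LINT x|lebesgue. norm (?f k x)) \<le> measure lebesgue {0..L} * (M * norm (d k))" for k
    proof -
      have "(LINT x|lebesgue. norm (?f k x)) \<le> (LINT x|lebesgue. indicator {0..L} x * (M * norm (d k)))"
        by (intro integral_mono integrable_norm int ii bnd)
      thus ?thesis by simp
    qed
    thus "summable (\<lambda>k. LINT x|lebesgue. norm (?f k x))"
      by (intro summable_comparison_test'[OF summable_mult[OF s, of "measure lebesgue {0..L}"], where N = 0]) auto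
  qed
  moreover have "(LINT x|lebesgue. ?f k x) = d k * of_real (LINT x:{0..L}|lebesgue. \<phi> x * ?s k x)" for k
    unfolding set_lebesgue_integral_def
    by (simp add: mult_ac scaleR_conv_of_real flip: integral_complex_of_real integral_mult_right_zero of_real_mult)
  moreover have "(\<Sum>k. ?f k x) = indicator {0..L} x *\<^sub>R (of_real (\<phi> x) * (\<Sum>k. d k * of_real (?s k x)))" for x
  proof -
    have "summable (\<lambda>k. d k * of_real (?s k x))"
      by (rule summable_comparison_test'[OF d, where N = 0]) (auto simp: norm_mult mult_left_le)
    from suminf_mult[OF this, of "of_real (indicator {0..L} x * \<phi> x)"] show ?thesis
      by (simp add: scaleR_conv_of_real mult_ac)
  qed
  ultimately show ?thesis unfolding set_lebesgue_integral_def by simp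
qed

lemma continuous_sine_series:
  fixes d :: "nat \<Rightarrow> complex"
  assumes d: "summable (\<lambda>k. norm (d k))"
  shows "continuous_on A (\<lambda>x. \<Sum>k. d k * of_real (sin (a * real (Suc k) * x)))"
proof -
  have "uniform_limit A (\<lambda>n x. \<Sum>k<n. d k * of_real (sin (a * real (Suc k) * x)))
          (\<lambda>x. \<Sum>k. d k * of_real (sin (a * real (Suc k) * x))) sequentially"
    by (rule Weierstrass_m_test[OF _ d]) (auto simp: norm_mult mult_left_le)
  thus ?thesis
    by (rule uniform_limit_theorem[rotated]) (auto intro!: always_eventually continuous_intros)
qed

section \<open>The imaginary part of the kernel\<close>

text \<open>In the decomposition into two hyperbolic tangents, \<open>tanh (x / 2)\<close> is real;
  only \<open>tanh ((w - x) / 2)\<close> contributes.\<close>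

lemma Im_strip_kernel:
  assumes w: "w \<in> strip"
  shows "Im (strip_kernel w (of_real x))
     = sin (Im w / 2) * cos (Im w / 2) / ((sinh ((x - Re w) / 2))\<^sup>2 + (cos (Im w / 2))\<^sup>2)"
proof -
  define A where "A = (w - of_real x) / 2"
  have A: "cosh A \<noteq> 0" unfolding A_def by (rule cosh_half_diff_nonzero[OF w])
  have "sinh (w / 2) = sinh (A + of_real x / 2)" by (simp add: A_def add_divide_distrib diff_divide_distrib)
  also have "\<dots> = sinh A * of_real (cosh (x / 2)) + cosh A * of_real (sinh (x / 2))"
    using sinh_of_real[of "x / 2"] by (simp add: sinh_add cosh_of_real_half)
  finally have "strip_kernel w (of_real x) = sinh A / cosh A + of_real (sinh (x / 2) / cosh (x / 2))"
    using A by (simp add: strip_kernel_def cosh_of_real_half field_simps flip: A_def)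
  hence "Im (strip_kernel w (of_real x)) = Im (sinh A * cnj (cosh A)) / (norm (cosh A))\<^sup>2"
    by (simp add: complex_div_cnj[of "sinh A"])
  also have "Im (sinh A * cnj (cosh A)) = sin (Im A) * cos (Im A) * ((cosh (Re A))\<^sup>2 - (sinh (Re A))\<^sup>2)"
    by (simp add: sinh_Complex cosh_Complex power2_eq_square algebra_simps)
  also have "(cosh (Re A))\<^sup>2 - (sinh (Re A))\<^sup>2 = 1" by (rule hyperbolic_pythagoras)
  also have "(norm (cosh A))\<^sup>2 = (sinh (Re A))\<^sup>2 + (cos (Im A))\<^sup>2" by (rule norm_cosh_squared)
  also have "Re A = - ((x - Re w) / 2)" by (simp add: A_def diff_divide_distrib)
  also have "Im A = Im w / 2" by (simp add: A_def)
  finally show ?thesis by (simp only: sinh_minus power2_minus mult_1_right)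
qed

text \<open>The integrand has an elementary antiderivative, and being nonnegative it admits the
  fundamental theorem on the whole line.\<close>

lemma integral_Im_strip_kernel:
  assumes w: "w \<in> strip" and Im: "Im w \<ge> 0"
  shows "(LINT x|lebesgue. Im (strip_kernel w (of_real x))) = 2 * Im w"
    and "Im (strip_kernel w (of_real x)) \<ge> 0"
proof -
  define s c u where "s = sin (Im w / 2)" and "c = cos (Im w / 2)" and "u = Re w"
  have c: "c > 0" unfolding c_def by (rule cos_half_pos[OF w])
  have s: "s \<ge> 0" unfolding s_def using w Im by (intro sin_ge_zero) (auto simp: strip_def)
  define f where "f = (\<lambda>x. s * c / ((sinh ((x - u) / 2))\<^sup>2 + c\<^sup>2))"
  \<comment> \<open>Since \<open>s / c = tan (Im w / 2)\<close>, the limits of \<open>F\<close> at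
    the two ends are \<open>- Im w\<close> and \<open>Im w\<close>.\<close>
  define F where "F = (\<lambda>x. 2 * arctan (s / c * tanh ((x - u) / 2)))"
  have eq: "(\<lambda>x. Im (strip_kernel w (of_real x))) = f"
    by (simp add: fun_eq_iff Im_strip_kernel[OF w] f_def s_def c_def u_def)
  have den: "(sinh ((x - u) / 2))\<^sup>2 + c\<^sup>2 > 0" for x using c by (simp add: add_nonneg_pos)
  have f_nonneg: "f x \<ge> 0" for x
    unfolding f_def using s c den[of x] by simp
  show "Im (strip_kernel w (of_real x)) \<ge> 0" using f_nonneg eq by metis
  have deriv: "DERIV F x :> f x" for x
  proof -
    define S H where "S = sinh ((x - u) / 2)" and "H = cosh ((x - u) / 2)"
    have H: "H > 0" "H\<^sup>2 = 1 + S\<^sup>2" by (simp_all add: H_def S_def cosh_square_eq)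
    have sc: "s\<^sup>2 = 1 - c\<^sup>2" by (simp add: s_def c_def sin_squared_eq)
    have t: "tanh ((x - u) / 2) = S / H" by (simp add: tanh_def S_def H_def)
    have lin: "DERIV (\<lambda>x. (x - u) / 2) x :> 1 / 2"
      by (auto intro!: derivative_eq_intros)
    have "DERIV (\<lambda>x. tanh ((x - u) / 2)) x :> (1 - (S / H)\<^sup>2) * (1 / 2)"
      unfolding t[symmetric] by (intro has_field_derivative_tanh lin) simp
    from DERIV_cmult[OF DERIV_chain2[OF DERIV_arctan DERIV_cmult[OF this, of "s / c"]], of 2]
    have "DERIV F x :> 2 * (inverse (1 + (s / c * (S / H))\<^sup>2) * (s / c * ((1 - (S / H)\<^sup>2) * (1 / 2))))"
      by (simp only: F_def t)
    also have "2 * (inverse (1 + (s / c * (S / H))\<^sup>2) * (s / c * ((1 - (S / H)\<^sup>2) * (1 / 2))))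
        = s * c * (H\<^sup>2 - S\<^sup>2) / (c\<^sup>2 * H\<^sup>2 + s\<^sup>2 * S\<^sup>2)"
    proof -
      define X D where "X = H\<^sup>2 - S\<^sup>2" and "D = c\<^sup>2 * H\<^sup>2 + s\<^sup>2 * S\<^sup>2"
      have X: "1 - (S / H)\<^sup>2 = X / H\<^sup>2" using H(1) by (simp add: X_def field_simps)
      have D: "1 + (s / c * (S / H))\<^sup>2 = D / (c\<^sup>2 * H\<^sup>2)"
        using H(1) c by (simp add: D_def field_simps)
      have "D > 0" unfolding D_def using H(1) c by (intro add_pos_nonneg) auto
      thus ?thesis unfolding X D X_def[symmetric] D_def[symmetric]
        using H(1) c by (simp add: power2_eq_square)
    qed
    \<comment> \<open>With \<open>H\<^sup>2 = 1 + S\<^sup>2\<close> and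
      \<open>s\<^sup>2 = 1 - c\<^sup>2\<close> the denominator collapses to
      \<open>S\<^sup>2 + c\<^sup>2\<close>.\<close>
    also have "\<dots> = f x"
      unfolding f_def S_def[symmetric] H(2) sc by (simp add: algebra_simps)
    finally show ?thesis .
  qed
  have cont: "isCont f x" for x
    unfolding f_def using den[of x] by (intro continuous_intros) auto
  have arc: "arctan (s / c) = Im w / 2"
  proof -
    have "s / c = tan (Im w / 2)" by (simp add: s_def c_def tan_def)
    thus ?thesis using w Im by (simp add: strip_def arctan_tan)
  qed
  have top: "filterlim (\<lambda>x. (x - u) / 2) at_top at_top" by real_asymp
  have bot: "filterlim (\<lambda>x. (x - u) / 2) at_bot at_bot" by real_asymp
  have "((\<lambda>x. F x) \<longlongrightarrow> 2 * arctan (s / c * 1)) at_top" "((\<lambda>x. F x) \<longlongrightarrow> 2 * arctan (s / c * (- 1))) at_bot"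
    unfolding F_def
    by (intro tendsto_intros filterlim_compose[OF tanh_real_at_top top] filterlim_compose[OF tanh_real_at_bot bot])+
  hence lim: "((F \<circ> real_of_ereal) \<longlongrightarrow> Im w) (at_left \<infinity>)" "((F \<circ> real_of_ereal) \<longlongrightarrow> - Im w) (at_right (-\<infinity>))"
    by (simp_all add: ereal_tendsto_simps arctan_minus arc)
  have "(LBINT x=-\<infinity>..\<infinity>. f x) = Im w - (- Im w)"
    by (rule interval_integral_FTC_nonneg[where F = F]) (use deriv cont f_nonneg lim in auto)
  moreover have "(LBINT x=-\<infinity>..\<infinity>. f x) = (LINT x|lborel. f x)"
    by (simp add: interval_lebesgue_integral_def set_lebesgue_integral_def)
  moreover have "(LINT x|lborel. f x) = (LINT x|lebesgue. f x)"
    using borel_measurable_continuous_onI[of f] cont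
    by (subst integral_completion) (auto simp: continuous_on_eq_continuous_within)
  ultimately show "(LINT x|lebesgue. Im (strip_kernel w (of_real x))) = 2 * Im w"
    by (simp add: eq)
qed

section \<open>The series on the strip\<close>

lemma norm_cos_le_exp: "norm (cos z) \<le> exp \<bar>Im z\<bar>" for z :: complex
proof -
  have "norm (exp (\<i> * z) + exp (- (\<i> * z))) \<le> exp \<bar>Im z\<bar> + exp \<bar>Im z\<bar>"
    by (intro norm_triangle_le add_mono) auto
  thus ?thesis by (simp add: cos_exp_eq norm_divide)
qed

definition strip_coeff :: "real \<Rightarrow> complex \<Rightarrow> nat \<Rightarrow> complex" where
  "strip_coeff a w n = (1 - cos (of_real a * w * of_nat n)) / of_real (sinh (a * pi * real n))"

text \<open>The numerator is at most \<open>2 * exp (a * n * b)\<close>, and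
  \<open>sinh y = exp y * (1 - exp (- 2 * y)) / 2\<close> with
  \<open>y = a * pi * n \<ge> a * pi\<close> bounds the denominator below. Stating it with
  \<open>b\<close> instead of \<open>\<bar>Im w\<bar>\<close> makes it uniform on balls.\<close>

lemma norm_strip_coeff_le:
  assumes a: "a > 0" and w: "\<bar>Im w\<bar> \<le> b" and n: "n \<ge> 1"
  shows "norm (strip_coeff a w n) \<le> 4 / (1 - exp (- 2 * a * pi)) * exp (- a * (pi - b)) ^ n"
proof -
  have b: "b \<ge> 0" using w by linarith
  define N where "N = real n"
  have N: "N \<ge> 1" using n by (simp add: N_def)
  have "norm (1 - cos (of_real a * w * of_nat n)) \<le> 1 + exp (a * N * b)"
  proof -
    have "\<bar>Im (of_real a * w * of_nat n)\<bar> = a * N * \<bar>Im w\<bar>" using a by (simp add: N_def abs_mult)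
    also have "\<dots> \<le> a * N * b" using a w N by (intro mult_left_mono) auto
    finally have "norm (cos (of_real a * w * of_nat n)) \<le> exp (a * N * b)"
      using norm_cos_le_exp order_trans exp_le_cancel_iff by blast
    thus ?thesis using norm_triangle_ineq4[of 1 "cos (of_real a * w * of_nat n)"] by simp
  qed
  also have "\<dots> \<le> 2 * exp (a * N * b)" using a b N by simp
  finally have num: "norm (1 - cos (of_real a * w * of_nat n)) \<le> 2 * exp (a * N * b)" .
  have pos: "1 - exp (- 2 * a * pi) > 0" using a by simp
  have "exp (- 2 * (a * pi * N)) \<le> exp (- 2 * a * pi)" using a N by simp
  hence "exp (a * pi * N) * (1 - exp (- 2 * a * pi)) / 2 \<le> exp (a * pi * N) * (1 - exp (- 2 * (a * pi * N))) / 2"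
    by (intro divide_right_mono mult_left_mono) auto
  also have "\<dots> = sinh (a * pi * N)" by (simp add: sinh_def algebra_simps flip: exp_add) (simp add: field_simps)
  finally have den: "exp (a * pi * N) * (1 - exp (- 2 * a * pi)) / 2 \<le> sinh (a * pi * N)" .
  have "norm (strip_coeff a w n) = norm (1 - cos (of_real a * w * of_nat n)) / sinh (a * pi * N)"
    using a by (simp add: strip_coeff_def norm_divide N_def)
  also have "\<dots> \<le> (2 * exp (a * N * b)) / (exp (a * pi * N) * (1 - exp (- 2 * a * pi)) / 2)"
    using pos by (intro frac_le num den) auto
  also have "\<dots> = 4 / (1 - exp (- 2 * a * pi)) * (exp (a * N * b) / exp (a * pi * N))"
    by (simp add: field_simps)
  also have "exp (a * N * b) / exp (a * pi * N) = exp (- a * (pi - b)) ^ n"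
    by (simp add: N_def algebra_simps flip: exp_diff exp_of_nat_mult)
  finally show ?thesis .
qed

lemma summable_strip_majorant:
  fixes a b K :: real
  assumes "a > 0" "b < pi"
  shows "summable (\<lambda>n. K * exp (- a * (pi - b)) ^ Suc n)"
proof -
  have "summable (\<lambda>n. exp (- a * (pi - b)) ^ n)"
    using assms by (intro summable_geometric) (simp add: mult_pos_pos)
  thus ?thesis by (intro summable_mult) (subst summable_Suc_iff)
qed

lemma summable_norm_strip_coeff:
  assumes a: "a > 0" and w: "w \<in> strip"
  shows "summable (\<lambda>k. norm (strip_coeff a w (Suc k)))"
proof (rule summable_comparison_test'[where N = 0])
  show "summable (\<lambda>k. 4 / (1 - exp (- 2 * a * pi)) * exp (- a * (pi - \<bar>Im w\<bar>)) ^ Suc k)"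
    using w by (intro summable_strip_majorant a) (auto simp: strip_def)
  show "norm (norm (strip_coeff a w (Suc k))) \<le> 4 / (1 - exp (- 2 * a * pi)) * exp (- a * (pi - \<bar>Im w\<bar>)) ^ Suc k" for k
    unfolding real_norm_def abs_norm_cancel by (rule norm_strip_coeff_le[OF a]) auto
qed

section \<open>Sine coefficients of bounded odd periodic functions\<close>

lemma set_integrable_bounded_Icc:
  fixes f :: "real \<Rightarrow> real"
  assumes "f \<in> borel_measurable lebesgue" "\<And>x. \<bar>f x\<bar> \<le> M" "l \<le> r"
  shows "set_integrable lebesgue {l..r} f" "\<bar>LINT x:{l..r}|lebesgue. f x\<bar> \<le> M * (r - l)"
proof -
  have M: "M \<ge> 0" using order_trans[OF abs_ge_zero assms(2)] .
  have bnd: "norm (indicator {l..r} x *\<^sub>R f x) \<le> indicator {l..r} x * M" for x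
    using assms(2) by (auto simp: indicator_def)
  have ii: "integrable lebesgue (\<lambda>x. indicator {l..r} x * M)"
    by (intro integrable_mult_left) (simp add: integrable_indicator_iff emeasure_lborel_Icc_eq)
  show int: "set_integrable lebesgue {l..r} f"
    unfolding set_integrable_def
  proof (rule Bochner_Integration.integrable_bound[OF ii])
    show "(\<lambda>x. indicator {l..r} x *\<^sub>R f x) \<in> borel_measurable lebesgue"
      using assms(1) by (intro borel_measurable_scaleR borel_measurable_indicator) auto
    show "AE x in lebesgue. norm (indicator {l..r} x *\<^sub>R f x) \<le> norm (indicator {l..r} x * M)"
      by (rule AE_I2) (use bnd M in \<open>simp add: abs_mult\<close>)
  qed
  have "norm (LINT x:{l..r}|lebesgue. f x) \<le> (LINT x|lebesgue. norm (indicator {l..r} x *\<^sub>R f x))"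
    unfolding set_lebesgue_integral_def by (rule integral_norm_bound)
  also have "\<dots> \<le> (LINT x|lebesgue. indicator {l..r} x * M)"
    by (intro integral_mono ii bnd integrable_norm int[unfolded set_integrable_def])
  also have "\<dots> = M * (r - l)" using assms(3) by simp
  finally show "\<bar>LINT x:{l..r}|lebesgue. f x\<bar> \<le> M * (r - l)" by simp
qed

context odd_periodic
begin

lemma integral_symmetric_sin:
  "(LINT x:{-p/2..p/2}|lebesgue. \<psi> x * sin (t * x)) = 2 * (LINT x:{0..p/2}|lebesgue. \<psi> x * sin (t * x))"
proof -
  let ?f = "\<lambda>x. \<psi> x * sin (t * x)"
  let ?u = "\<lambda>x. indicator {0..p/2} x *\<^sub>R ?f x" and ?v = "\<lambda>x. indicator {-p/2..0} x *\<^sub>R ?f x"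
  have fm: "?f \<in> borel_measurable lebesgue"
    by (intro borel_measurable_times meas borel_measurable_lebesgue_continuous[of "\<lambda>x. sin (t * x)"] continuous_intros)
  have fb: "\<bar>?f x\<bar> \<le> M * 1" for x
    unfolding abs_mult using M_nonneg by (intro mult_mono bounded) auto
  have u: "integrable lebesgue ?u" and v: "integrable lebesgue ?v"
    using set_integrable_bounded_Icc(1)[OF fm fb] p_pos by (simp_all add: set_integrable_def)
  have "(LINT x:{-p/2..p/2}|lebesgue. ?f x) = (LINT x|lebesgue. ?u x + ?v x)"
    unfolding set_lebesgue_integral_def using p_pos
    by (intro Bochner_Integration.integral_cong) (auto simp: indicator_def zero)
  also have "\<dots> = (LINT x|lebesgue. ?u x) + (LINT x|lebesgue. ?v x)"
    by (rule Bochner_Integration.integral_add[OF u v])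
  also have "(LINT x|lebesgue. ?v x) = (LINT x|lebesgue. ?v (0 + (- 1) * x))"
    by (subst lebesgue_integral_real_affine[of "- 1" _ 0]) auto
  also have "\<dots> = (LINT x|lebesgue. ?u x)"
    by (intro Bochner_Integration.integral_cong) (auto simp: indicator_def odd)
  finally show ?thesis by (simp add: set_lebesgue_integral_def)
qed

end

lemma odd_periodic_sin:
  assumes "a > 0" shows "odd_periodic (\<lambda>x. sin (a * real n * x)) (2 * pi / a) 1"
proof
  show "sin (a * real n * (x + 2 * pi / a)) = sin (a * real n * x)" for x
  proof -
    have "a * real n * (x + 2 * pi / a) = a * real n * x + 2 * real n * pi"
      using assms by (simp add: field_simps)
    thus ?thesis by (simp add: sin_add)
  qed
qed (use assms in \<open>auto intro!: borel_measurable_lebesgue_continuous continuous_intros\<close>)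

lemma set_lebesgue_integral_continuous:
  fixes f :: "real \<Rightarrow> complex"
  assumes "continuous_on {l..r} f"
  shows "(LINT x:{l..r}|lebesgue. f x) = integral {l..r} f"
  by (intro set_lebesgue_integral_eq_integral absolutely_integrable_continuous_real assms)

text \<open>A Parseval formula between \<open>\<psi>\<close> and the folded kernel, obtained by
  showing that the folded kernel and the series \<open>T\<close> are continuous with equal sine
  coefficients.\<close>

lemma strip_kernel_sine_series:
  fixes a p :: real
  assumes a: "a > 0" and p: "p = 2 * pi / a" and \<psi>: "odd_periodic \<psi> p M" and w: "w \<in> strip"
  shows "(\<lambda>k. 4 * of_real a * strip_coeff a w (Suc k) * of_real (LINT x:{0..p/2}|lebesgue. \<psi> x * sin (a * real (Suc k) * x)))
    sums (LINT x|lebesgue. of_real (\<psi> x) * strip_kernel w (of_real x))"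
proof -
  interpret odd_periodic \<psi> p M by fact
  define g where "g = (\<lambda>x::real. strip_kernel w (of_real x))"
  obtain C where gC: "exp_decaying g C" unfolding g_def by (rule exp_decaying_strip_kernel[OF w])
  interpret exp_decaying g C by fact
  interpret half_period_folding \<psi> p M g C by unfold_locales
  \<comment> \<open>The factor is \<open>2 * a / pi\<close>, the normalisation of sine coefficients
    on \<open>{0..pi / a}\<close>, times the \<open>2 * pi\<close> of
    \<open>strip_kernel_fourier_sin\<close>.\<close>
  define d where "d = (\<lambda>k. 4 * of_real a * strip_coeff a w (Suc k))"
  define T where "T = (\<lambda>x. \<Sum>k. d k * of_real (sin (a * real (Suc k) * x)))"
  have d: "summable (\<lambda>k. norm (d k))"
    unfolding d_def norm_mult by (intro summable_mult summable_norm_strip_coeff a w)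
  have p2: "p / 2 = pi / a" by (simp add: p)
  have T_cont: "continuous_on A T" for A unfolding T_def by (rule continuous_sine_series[OF d])
  have E_cont: "continuous_on {0..pi / a} (folded p g)"
    using continuous_on_folded[OF p_pos] by (simp add: p2)
  have coeff_E: "integral {0..pi / a} (\<lambda>x. of_real (sin (a * real n * x)) * folded p g x)
      = 2 * of_real pi * strip_coeff a w n" if "n \<ge> 1" for n
  proof -
    interpret s: odd_periodic "\<lambda>x. sin (a * real n * x)" p 1
      unfolding p by (rule odd_periodic_sin[OF a])
    interpret s: half_period_folding "\<lambda>x. sin (a * real n * x)" p 1 g C by unfold_locales
    have "integral {0..pi / a} (\<lambda>x. of_real (sin (a * real n * x)) * folded p g x)
        = (LINT x:{0..p/2}|lebesgue. of_real (sin (a * real n * x)) * folded p g x)"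
      unfolding p2 by (intro set_lebesgue_integral_continuous[symmetric] continuous_intros E_cont)
    also have "\<dots> = (LINT x|lebesgue. of_real (sin (a * real n * x)) * g x)"
      by (rule s.integral_folded[symmetric])
    also have "\<dots> = 2 * of_real pi * strip_coeff a w n"
      using strip_kernel_fourier_sin[OF w, of "a * real n"] a that
      by (simp add: g_def strip_coeff_def mult_ac)
    finally show ?thesis .
  qed
  have coeff_T: "integral {0..pi / a} (\<lambda>x. of_real (sin (a * real n * x)) * T x)
      = 2 * of_real pi * strip_coeff a w n" if n: "n \<ge> 1" for n
  proof -
    have sm: "(\<lambda>x. sin (a * real n * x)) \<in> borel_measurable lebesgue"
      by (intro borel_measurable_lebesgue_continuous continuous_intros)
    have "(\<lambda>k. d k * of_real (LINT x:{0..pi / a}|lebesgue. sin (a * real n * x) * sin (a * real (Suc k) * x)))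
       sums (LINT x:{0..pi / a}|lebesgue. of_real (sin (a * real n * x)) * T x)"
      unfolding T_def by (rule sums_integral_sine_series[OF sm _ d, where M = 1]) simp
    \<comment> \<open>The series is indexed from 0, so frequency \<open>n\<close> sits at index
      \<open>n - 1\<close>.\<close>
    also have "(\<lambda>k. d k * of_real (LINT x:{0..pi / a}|lebesgue. sin (a * real n * x) * sin (a * real (Suc k) * x)))
        = (\<lambda>k. if k = n - 1 then d k * of_real (pi / (2 * a)) else 0)"
    proof
      fix k
      have "(LINT x:{0..pi / a}|lebesgue. sin (a * real n * x) * sin (a * real (Suc k) * x))
          = integral {0..pi / a} (\<lambda>x. sin (a * real n * x) * sin (a * real (Suc k) * x))"
        by (intro set_lebesgue_integral_eq_integral absolutely_integrable_continuous_real continuous_intros)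
      also have "\<dots> = (if n = Suc k then pi / (2 * a) else 0)"
        by (rule sine_orthogonality[OF a]) simp
      finally show "d k * of_real (LINT x:{0..pi / a}|lebesgue. sin (a * real n * x) * sin (a * real (Suc k) * x))
          = (if k = n - 1 then d k * of_real (pi / (2 * a)) else 0)"
        using n by auto
    qed
    finally have "(LINT x:{0..pi / a}|lebesgue. of_real (sin (a * real n * x)) * T x) = d (n - 1) * of_real (pi / (2 * a))"
      using sums_single[of "n - 1" "\<lambda>k. d k * of_real (pi / (2 * a))"] by (rule sums_unique2)
    also have "\<dots> = 2 * of_real pi * strip_coeff a w n"
      using a n by (simp add: d_def)
    also have "(LINT x:{0..pi / a}|lebesgue. of_real (sin (a * real n * x)) * T x)
        = integral {0..pi / a} (\<lambda>x. of_real (sin (a * real n * x)) * T x)"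
      by (intro set_lebesgue_integral_continuous continuous_intros T_cont)
    finally show ?thesis .
  qed
  have E_eq_T: "folded p g x = T x" if "0 < x" "x < pi / a" for x
    by (rule sine_coefficients_unique_complex[OF a E_cont T_cont _ that]) (simp add: coeff_E coeff_T)
  have "(LINT x|lebesgue. of_real (\<psi> x) * g x) = (LINT x:{0..p/2}|lebesgue. of_real (\<psi> x) * folded p g x)"
    by (rule integral_folded)
  also have "\<dots> = (LINT x:{0..p/2}|lebesgue. of_real (\<psi> x) * T x)"
    unfolding set_lebesgue_integral_def
  proof (intro Bochner_Integration.integral_cong refl)
    fix x
    consider "x = 0" | "x = p / 2" | "0 < x" "x < pi / a" | "x \<notin> {0..p/2}"
      using p2 by fastforce
    thus "indicator {0..p/2} x *\<^sub>R (of_real (\<psi> x) * folded p g x) = indicator {0..p/2} x *\<^sub>R (of_real (\<psi> x) * T x)"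
    proof cases
      case 2
      thus ?thesis by (simp only: half) simp
    qed (simp_all add: zero E_eq_T)
  qed
  finally show ?thesis
    using sums_integral_sine_series[OF meas bounded d, of "p / 2" a]
    unfolding g_def T_def d_def by simp
qed

section \<open>Analyticity of the series and the bound on the imaginary part\<close>

lemma strip_coeff_holomorphic: "a > 0 \<Longrightarrow> n \<ge> 1 \<Longrightarrow> (\<lambda>w. strip_coeff a w n) holomorphic_on A"
  unfolding strip_coeff_def by (intro holomorphic_intros) auto

lemma open_strip: "open strip"
proof -
  have "strip = {z. - pi < Im z} \<inter> {z. Im z < pi}" by (auto simp: strip_def)
  thus ?thesis by (metis open_Int open_halfspace_Im_gt open_halfspace_Im_lt)
qed

lemma holomorphic_strip_series:
  assumes a: "a > 0" and B: "\<And>n. n \<ge> 1 \<Longrightarrow> \<bar>B n\<bar> \<le> 1"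
  shows "(\<lambda>w. \<Sum>k. of_real (B (Suc k)) * strip_coeff a w (Suc k)) holomorphic_on strip"
proof (rule holomorphic_uniform_sequence[OF open_strip])
  show "(\<lambda>w. \<Sum>k<n. of_real (B (Suc k)) * strip_coeff a w (Suc k)) holomorphic_on strip" for n
    by (intro holomorphic_intros strip_coeff_holomorphic a) auto
  fix w assume w: "w \<in> strip"
  \<comment> \<open>Half the distance from \<open>w\<close> to the boundary of the strip, so that
    \<open>b\<close>, which bounds \<open>\<bar>Im z\<bar>\<close> on the closed ball, stays below
    \<open>pi\<close>.\<close>
  define \<delta> where "\<delta> = (pi - \<bar>Im w\<bar>) / 2"
  define b where "b = \<bar>Im w\<bar> + \<delta>"
  have \<delta>: "\<delta> > 0" "b < pi" using w by (auto simp: \<delta>_def b_def strip_def field_simps)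
  have Im_le: "\<bar>Im z\<bar> \<le> b" if "z \<in> cball w \<delta>" for z
    using that abs_Im_le_cmod[of "w - z"] by (simp add: b_def dist_norm)
  have "uniform_limit (cball w \<delta>) (\<lambda>n z. \<Sum>k<n. of_real (B (Suc k)) * strip_coeff a z (Suc k))
      (\<lambda>z. \<Sum>k. of_real (B (Suc k)) * strip_coeff a z (Suc k)) sequentially"
  proof (rule Weierstrass_m_test)
    show "summable (\<lambda>k. 4 / (1 - exp (- 2 * a * pi)) * exp (- a * (pi - b)) ^ Suc k)"
      by (intro summable_strip_majorant a \<delta>)
    fix k z assume "z \<in> cball w \<delta>"
    have "norm (of_real (B (Suc k)) * strip_coeff a z (Suc k)) \<le> 1 * norm (strip_coeff a z (Suc k))"
      unfolding norm_mult using B[of "Suc k"] by (intro mult_right_mono) auto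
    also have "\<dots> \<le> 4 / (1 - exp (- 2 * a * pi)) * exp (- a * (pi - b)) ^ Suc k"
      using norm_strip_coeff_le[OF a Im_le[OF \<open>z \<in> cball w \<delta>\<close>], of "Suc k"] by simp
    finally show "norm (of_real (B (Suc k)) * strip_coeff a z (Suc k))
        \<le> 4 / (1 - exp (- 2 * a * pi)) * exp (- a * (pi - b)) ^ Suc k" .
  qed
  moreover have "cball w \<delta> \<subseteq> strip"
    using Im_le \<delta> by (auto simp: strip_def abs_le_iff) (smt (verit))+
  ultimately show "\<exists>d>0. cball w d \<subseteq> strip \<and> uniform_limit (cball w d)
      (\<lambda>n z. \<Sum>k<n. of_real (B (Suc k)) * strip_coeff a z (Suc k))
      (\<lambda>z. \<Sum>k. of_real (B (Suc k)) * strip_coeff a z (Suc k)) sequentially"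
    using \<delta>(1) by blast
qed

lemma abs_Im_strip_integral_le:
  assumes w: "w \<in> strip" "Im w \<ge> 0" and \<psi>: "\<psi> \<in> borel_measurable lebesgue" "\<And>x. \<bar>\<psi> x\<bar> \<le> M"
  shows "\<bar>Im (LINT x|lebesgue. of_real (\<psi> x) * strip_kernel w (of_real x))\<bar> \<le> 2 * M * Im w"
proof -
  let ?f = "\<lambda>x. of_real (\<psi> x) * strip_kernel w (of_real x)"
  have f: "integrable lebesgue ?f"
    by (rule integrable_mult_strip_kernel[OF w(1), where M = M]) (use \<psi> in auto)
  have "integrable lebesgue (\<lambda>x. 1 * strip_kernel w (of_real x))"
    by (rule integrable_mult_strip_kernel[OF w(1), where M = 1]) auto
  hence k: "integrable lebesgue (\<lambda>x. M * Im (strip_kernel w (of_real x)))"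
    by (intro integrable_mult_right integrable_Im) simp
  have "Im (LINT x|lebesgue. ?f x) = (LINT x|lebesgue. Im (?f x))"
    by (rule integral_Im[OF f, symmetric])
  also have "norm \<dots> \<le> (LINT x|lebesgue. norm (Im (?f x)))" by (rule integral_norm_bound)
  also have "\<dots> \<le> (LINT x|lebesgue. M * Im (strip_kernel w (of_real x)))"
  proof (intro integral_mono integrable_norm integrable_Im f k)
    fix x
    show "norm (Im (?f x)) \<le> M * Im (strip_kernel w (of_real x))"
      using mult_mono[OF \<psi>(2)[of x] order_refl[of "Im (strip_kernel w (of_real x))"]]
        integral_Im_strip_kernel(2)[OF w, of x] order_trans[OF abs_ge_zero \<psi>(2)]
      by (simp add: abs_mult)
  qed
  also have "\<dots> = 2 * M * Im w" by (simp add: integral_Im_strip_kernel(1)[OF w])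
  finally show ?thesis by simp
qed

theorem theorem17:
  fixes a p :: real and \<Psi> :: "real \<Rightarrow> real" and B :: "nat \<Rightarrow> real" and S :: "complex \<Rightarrow> complex"
  assumes "a > 0"
    and "p = 2 * pi / a"
    and "\<Psi> \<in> borel_measurable lebesgue"
    and "\<And>x. \<Psi> (- x) = - \<Psi> x"
    and "\<And>x. \<Psi> (x + p) = \<Psi> x"
    and "\<And>x. \<bar>\<Psi> x\<bar> \<le> 1/2"
    and "is_fourier_series p \<Psi> (\<lambda>_. 0) B"
    and "\<And>w. w \<in> strip \<Longrightarrow>
           S w = 1/2 * (LINT x|lebesgue. of_real (\<Psi> x) * sinh (w / 2) /
                          (of_real (cosh (x / 2)) * cosh ((w - of_real x) / 2)))"
  shows "S \<in> W_class p \<and>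
    (\<forall>w\<in>strip.
       summable (\<lambda>n. of_real (B (Suc n)) *
         ((1 - cos (of_real a * w * of_nat (Suc n))) / of_real (sinh (a * pi * real (Suc n))))) \<and>
       S w = of_real pi * (\<Sum>n. of_real (B (Suc n)) *
         ((1 - cos (of_real a * w * of_nat (Suc n))) / of_real (sinh (a * pi * real (Suc n))))) \<and>
       summable (\<lambda>n. of_real (B (Suc n)) *
         ((sin (of_real a * w * of_nat (Suc n) / 2))\<^sup>2 / of_real (sinh (a * pi * real (Suc n)))) :: complex) \<and>
       S w = 2 * of_real pi * (\<Sum>n. of_real (B (Suc n)) *
         ((sin (of_real a * w * of_nat (Suc n) / 2))\<^sup>2 / of_real (sinh (a * pi * real (Suc n))))))"
proof -
  have a: "a > 0" and p: "p = 2 * pi / a" by fact+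
  interpret odd_periodic \<Psi> p "1/2"
    by unfold_locales (use assms in \<open>auto simp: p\<close>)
  have S_eq: "S w = 1/2 * (LINT x|lebesgue. of_real (\<Psi> x) * strip_kernel w (of_real x))" if "w \<in> strip" for w
    using assms(8)[OF that] by (simp add: strip_kernel_def cosh_of_real_half)
  let ?c = "\<lambda>w k. of_real (B (Suc k)) * strip_coeff a w (Suc k)"
  have B_eq: "B n = 2 / p * (LINT x:{-p/2..p/2}|lebesgue. \<Psi> x * sin (a * real n * x))" if "n \<ge> 1" for n
  proof -
    have "2 * pi * real n * x / p = a * real n * x" for x using a by (simp add: p)
    thus ?thesis using assms(7) that by (simp add: is_fourier_series_def)
  qed
  have B_half: "B n = 4 / p * (LINT x:{0..p/2}|lebesgue. \<Psi> x * sin (a * real n * x))" if "n \<ge> 1" for n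
    unfolding B_eq[OF that] integral_symmetric_sin by simp
  \<comment> \<open>The prefactor \<open>2 / p\<close> cancels the length \<open>p\<close>, and the
    bound 1/2 on \<open>\<Psi>\<close> leaves 1.\<close>
  have B_le: "\<bar>B n\<bar> \<le> 1" if "n \<ge> 1" for n
  proof -
    have fm: "(\<lambda>x. \<Psi> x * sin (a * real n * x)) \<in> borel_measurable lebesgue"
      by (intro borel_measurable_times meas borel_measurable_lebesgue_continuous[of "\<lambda>x. sin (a * real n * x)"]
            continuous_intros)
    have fb: "\<bar>\<Psi> x * sin (a * real n * x)\<bar> \<le> 1/2 * 1" for x
      unfolding abs_mult by (intro mult_mono bounded) auto
    have "\<bar>LINT x:{-p/2..p/2}|lebesgue. \<Psi> x * sin (a * real n * x)\<bar> \<le> 1/2 * 1 * (p/2 - (-p/2))"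
      by (rule set_integrable_bounded_Icc(2)[OF fm fb]) (use p_pos in simp)
    thus ?thesis unfolding B_eq[OF that] using p_pos by (simp add: abs_mult field_simps)
  qed
  have sums: "?c w sums (S w / of_real pi)" if w: "w \<in> strip" for w
  proof -
    \<comment> \<open>By \<open>B_half\<close> and \<open>p = 2 * pi / a\<close> the coefficient is
      \<open>2 * a / pi\<close> times the integral. The remaining 2 cancels the prefactor 1/2 of
      \<open>S\<close>.\<close>
    have eq: "4 * of_real a * strip_coeff a w (Suc k) * of_real (LINT x:{0..p/2}|lebesgue. \<Psi> x * sin (a * real (Suc k) * x))
        = 2 * of_real pi * ?c w k" for k
    proof -
      define J where "J = (LINT x:{0..p/2}|lebesgue. \<Psi> x * sin (a * real (Suc k) * x))"
      have "B (Suc k) = 4 / p * J" unfolding J_def by (rule B_half) simp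
      hence "B (Suc k) = 2 * a / pi * J" by (simp add: p)
      thus ?thesis unfolding J_def[symmetric] by simp
    qed
    have "(\<lambda>k. 2 * of_real pi * ?c w k) sums (2 * S w)"
      using strip_kernel_sine_series[OF a p odd_periodic_axioms w] unfolding eq S_eq[OF w] by simp
    from sums_divide[OF this, of "2 * of_real pi"] show ?thesis by simp
  qed
  have S_series: "S w = of_real pi * (\<Sum>k. ?c w k)" if "w \<in> strip" for w
    unfolding sums_unique[OF sums[OF that], symmetric] by simp
  have "S \<in> W_class p"
    unfolding W_class_def
  proof (intro CollectI conjI allI ballI impI)
    have "(\<lambda>w. of_real pi * (\<Sum>k. ?c w k)) holomorphic_on strip"
      by (intro holomorphic_intros holomorphic_strip_series a B_le)
    hence "S holomorphic_on strip"
      by (rule holomorphic_transform) (simp add: S_series)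
    thus "S analytic_on strip" using open_strip by (simp add: analytic_on_open)
  next
    fix w assume w: "0 \<le> Im w \<and> Im w < pi"
    hence w': "w \<in> strip" by (auto simp: strip_def)
    \<comment> \<open>With \<open>M = 1/2\<close> the integral is bounded by \<open>Im w\<close>;
      the prefactor 1/2 of \<open>S\<close> gives exactly the constant of the class.\<close>
    have "\<bar>Im (S w)\<bar> = 1/2 * \<bar>Im (LINT x|lebesgue. of_real (\<Psi> x) * strip_kernel w (of_real x))\<bar>"
      by (simp add: S_eq[OF w'])
    also have "\<dots> \<le> 1/2 * (2 * (1/2) * Im w)"
      by (intro mult_left_mono abs_Im_strip_integral_le w' meas bounded) (use w in auto)
    finally show "\<bar>Im (S w)\<bar> \<le> 1/2 * Im w" by simp
  next
    have "0 \<in> strip" by (simp add: strip_def)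
    thus "S 0 = 0" by (simp add: S_series strip_coeff_def)
  next
    fix w assume w: "w \<in> strip"
    hence w': "- w \<in> strip" by (auto simp: strip_def)
    show "S (- w) = S w" by (simp add: S_series[OF w] S_series[OF w'] strip_coeff_def)
  next
    fix w assume w: "w \<in> strip"
    hence w': "w + of_real p \<in> strip" by (simp add: strip_def)
    have "cos (of_real a * (w + of_real p) * of_nat n) = cos (of_real a * w * of_nat n)" for n
    proof -
      have "of_real a * (w + of_real p) * of_nat n = of_real a * w * of_nat n + of_real (2 * real n * pi)"
        using a by (simp add: p field_simps)
      thus ?thesis by (simp only: cos_add cos_of_real sin_of_real cos_2npi sin_2npi) simp
    qed
    thus "S (w + of_real p) = S w" by (simp only: S_series[OF w] S_series[OF w'] strip_coeff_def)
  qed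
  moreover
  have "summable (?c w)" "S w = of_real pi * (\<Sum>k. ?c w k)"
    "summable (\<lambda>n. of_real (B (Suc n)) *
         ((sin (of_real a * w * of_nat (Suc n) / 2))\<^sup>2 / of_real (sinh (a * pi * real (Suc n)))) :: complex)"
    "S w = 2 * of_real pi * (\<Sum>n. of_real (B (Suc n)) *
         ((sin (of_real a * w * of_nat (Suc n) / 2))\<^sup>2 / of_real (sinh (a * pi * real (Suc n)))))"
    if w: "w \<in> strip" for w
  proof -
    show "summable (?c w)" using sums[OF w] by (rule sums_summable)
    show "S w = of_real pi * (\<Sum>k. ?c w k)" by (rule S_series[OF w])
    let ?s = "\<lambda>n. of_real (B (Suc n)) *
         ((sin (of_real a * w * of_nat (Suc n) / 2))\<^sup>2 / of_real (sinh (a * pi * real (Suc n)))) :: complex"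
    \<comment> \<open>\<open>1 - cos (2 * y) = 2 * (sin y)\<^sup>2\<close>, so the two series agree
      term by term up to a factor 2.\<close>
    have eq: "?s n = ?c w n / 2" for n
      using cos_double_sin[of "of_real a * w * of_nat (Suc n) / 2"]
      by (simp add: strip_coeff_def del: of_nat_Suc)
    have s: "?s sums (S w / of_real pi / 2)"
      unfolding eq by (rule sums_divide[OF sums[OF w]])
    thus "summable ?s" by (rule sums_summable)
    show "S w = 2 * of_real pi * (\<Sum>n. ?s n)"
      unfolding sums_unique[OF s, symmetric] by simp
  qed
  ultimately show ?thesis unfolding strip_coeff_def by blast
qed

end
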